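(* Let $K\subseteq\mathbb{R}^n$ be a smooth convex body. Then $$\xi(K)\ \le\ 2(n+1)\ \mathrm{inrad}(K),$$ where $\xi(K)$ denotes the length of the shortest periodic billiard trajectory in $K$ and $\mathrm{inrad}(K)$ is the inradius of $K$, i.e. the radius of the largest Euclidean ball contained in $K$.
   Context: A convex body in $\mathbb{R}^n$ is a compact convex set with non-empty interior; it is smooth if its boundary is smooth. Periodic billiard trajectories (this notion includes gliding trajectories along the boundary). Let $K\subset\mathbb{R}^n_q$ be a smooth convex body, translated so that $0\in \mathrm{int}(K)$ (all notions are translation invariant), and let $B\subset\mathbb{R}^n_p$ be the closed Euclidean unit ball. Let $g_K(q)=\inf\{r>0 : q\in rK\}$ and $g_B(p)=|p|$. A loop $\gamma:S^1\to\mathbb{R}^{2n}=\mathbb{R}^n_q\times\mathbb{R}^n_p$ is piecewise smooth if it is continuous, has left and right derivatives at all points, and is smooth outside some measure-zero subset of $S^1$. A closed $(K,B)$-billiard trajectory is (the image of) a piecewise smooth map $\gamma=(q,p):S^1\to\partial(K\times B)$ such that, with $\mathcal{B}_\gamma=\{t\in S^1: \gamma(t)\in\partial K\times\partial B\}$: (i) there is a constant $d>0$ such that for every $t\notin\mathcal{B}_\gamma$, $\dot\gamma(t)=d\,(-\nabla g_B(p(t)),0)$ if $\gamma(t)\in \mathrm{int}(K)\times\partial B$, and $\dot\gamma(t)=d\,(0,\nabla g_K(q(t)))$ if $\gamma(t)\in\partial K\times \mathrm{int}(B)$; (ii) for every $t\in\mathcal{B}_\gamma$ the left and right derivatives $\dot\gamma^{\pm}(t)$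 each belong to $\{\alpha(-\nabla g_B(p(t)),0)+\beta(0,\nabla g_K(q(t))) : \alpha,\beta\ge 0,\ (\alpha,\beta)\ne(0,0)\}$. A periodic billiard trajectory in $K$ is the closed curve $q$ (the projection of such a $\gamma$ to $\mathbb{R}^n_q$), and its length is its Euclidean length. $\xi(K)$ is the minimum of the lengths of all periodic billiard trajectories in $K$. *)

theory Defs
  imports "HOL-Analysis.Analysis"
begin

text \<open>Only used for open \<open>U\<close> and a finite-dimensional domain, where differentiability together
  with smoothness of all directional derivatives is the usual notion.\<close>

fun C_k_on :: "nat \<Rightarrow> ('a::real_normed_vector \<Rightarrow> 'b::real_normed_vector) \<Rightarrow> 'a set \<Rightarrow> bool" where
  "C_k_on 0 f U \<longleftrightarrow> continuous_on U f"
| "C_k_on (Suc k) f U \<longleftrightarrow>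
     (\<forall>x\<in>U. f differentiable (at x)) \<and>
     (\<forall>v. C_k_on k (\<lambda>x. frechet_derivative f (at x) v) U)"

definition smooth_on :: "('a::real_normed_vector \<Rightarrow> 'b::real_normed_vector) \<Rightarrow> 'a set \<Rightarrow> bool" where
  "smooth_on f U \<longleftrightarrow> (\<forall>k. C_k_on k f U)"

text \<open>Embedded hypersurfaces, described by local smooth defining functions.\<close>

definition smooth_hypersurface :: "'a::euclidean_space set \<Rightarrow> bool" where
  "smooth_hypersurface S \<longleftrightarrow>
     (\<forall>x\<in>S. \<exists>U (F :: 'a \<Rightarrow> real). open U \<and> x \<in> U \<and> smooth_on F U \<and>
        S \<inter> U = {y\<in>U. F y = 0} \<and>
        (\<forall>y\<in>S \<inter> U. frechet_derivative F (at y) \<noteq> (\<lambda>_. 0)))"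

definition convex_body :: "'a::euclidean_space set \<Rightarrow> bool" where
  "convex_body K \<longleftrightarrow> compact K \<and> convex K \<and> interior K \<noteq> {}"

definition smooth_convex_body :: "'a::euclidean_space set \<Rightarrow> bool" where
  "smooth_convex_body K \<longleftrightarrow> convex_body K \<and> smooth_hypersurface (frontier K)"

definition inrad :: "'a::euclidean_space set \<Rightarrow> real" where
  "inrad K = (GREATEST r. 0 \<le> r \<and> (\<exists>x. cball x r \<subseteq> K))"

definition minkowski_gauge :: "'a::euclidean_space set \<Rightarrow> 'a \<Rightarrow> real" where
  "minkowski_gauge K q = Inf {r. r > 0 \<and> q \<in> (*\<^sub>R) r ` K}"

definition gradient :: "('a::euclidean_space \<Rightarrow> real) \<Rightarrow> 'a \<Rightarrow> 'a" where
  "gradient f x = (THE D. GDERIV f x :> D)"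

text \<open>Loops \<open>S\<^sup>1 \<rightarrow> E\<close> are represented by 1-periodic functions on the real line.\<close>

definition piecewise_smooth_loop :: "(real \<Rightarrow> 'a::real_normed_vector) \<Rightarrow> bool" where
  "piecewise_smooth_loop \<gamma> \<longleftrightarrow>
     (\<forall>t. \<gamma> (t + 1) = \<gamma> t) \<and>
     continuous_on UNIV \<gamma> \<and>
     (\<forall>t. (\<exists>v. (\<gamma> has_vector_derivative v) (at_left t)) \<and>
          (\<exists>v. (\<gamma> has_vector_derivative v) (at_right t))) \<and>
     (\<exists>N. negligible N \<and> (\<forall>t. t \<notin> N \<longrightarrow> (\<exists>U. open U \<and> t \<in> U \<and> smooth_on \<gamma> U)))"

definition velocity_cone ::
  "'a::euclidean_space set \<Rightarrow> 'a \<times> 'a \<Rightarrow> ('a \<times> 'a) set" where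
  "velocity_cone K z =
     {\<alpha> *\<^sub>R (- gradient norm (snd z), 0) + \<beta> *\<^sub>R (0, gradient (minkowski_gauge K) (fst z))
       | \<alpha> \<beta>. \<alpha> \<ge> 0 \<and> \<beta> \<ge> 0 \<and> (\<alpha>, \<beta>) \<noteq> (0, 0)}"

text \<open>Closed \<open>(K, B)\<close>-billiard trajectories for the closed unit ball \<open>B\<close>, whose gauge is the norm.
  This is meant for convex bodies with \<open>0 \<in> interior K\<close>.\<close>

definition closed_KB_billiard :: "'a::euclidean_space set \<Rightarrow> (real \<Rightarrow> 'a \<times> 'a) \<Rightarrow> bool" where
  "closed_KB_billiard K \<gamma> \<longleftrightarrow>
     piecewise_smooth_loop \<gamma> \<and>
     range \<gamma> \<subseteq> frontier (K \<times> cball 0 1) \<and>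
     (\<exists>d>0. \<forall>t. \<gamma> t \<notin> frontier K \<times> sphere 0 1 \<longrightarrow>
        (\<gamma> t \<in> interior K \<times> sphere 0 1 \<longrightarrow>
           (\<gamma> has_vector_derivative d *\<^sub>R (- gradient norm (snd (\<gamma> t)), 0)) (at t)) \<and>
        (\<gamma> t \<in> frontier K \<times> ball 0 1 \<longrightarrow>
           (\<gamma> has_vector_derivative d *\<^sub>R (0, gradient (minkowski_gauge K) (fst (\<gamma> t)))) (at t))) \<and>
     (\<forall>t. \<gamma> t \<in> frontier K \<times> sphere 0 1 \<longrightarrow>
        (\<exists>v \<in> velocity_cone K (\<gamma> t). (\<gamma> has_vector_derivative v) (at_left t)) \<and>
        (\<exists>v \<in> velocity_cone K (\<gamma> t). (\<gamma> has_vector_derivative v) (at_right t)))"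

text \<open>An arbitrary \<open>K\<close> is first translated so that the origin is an interior point; the curves \<open>q\<close>
  and their lengths do not depend on the choice of the point \<open>c\<close> moved to the origin, up to
  reparametrisation of \<open>\<gamma>\<close>.\<close>

definition periodic_billiard_trajectory :: "'a::euclidean_space set \<Rightarrow> (real \<Rightarrow> 'a) \<Rightarrow> bool" where
  "periodic_billiard_trajectory K q \<longleftrightarrow>
     (\<exists>c p. c \<in> interior K \<and> closed_KB_billiard ((\<lambda>x. x - c) ` K) (\<lambda>t. (q t - c, p t)))"

definition loop_length :: "(real \<Rightarrow> 'a::metric_space) \<Rightarrow> ereal" where
  "loop_length q =
     (SUP ts \<in> {ts. sorted ts \<and> set ts \<subseteq> {0..1}}.
        ereal (\<Sum>i<length ts - 1. dist (q (ts ! i)) (q (ts ! Suc i))))"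

text \<open>The minimum, not just the infimum: \<open>LEAST\<close> is unspecified unless a shortest trajectory exists.\<close>

definition xi :: "'a::euclidean_space set \<Rightarrow> ereal" where
  "xi K = (LEAST l. \<exists>q. periodic_billiard_trajectory K q \<and> l = loop_length q)"

end

theory Submission
  imports Defs
begin

text \<open>
  A closed curve is pinned if no translate of it lies in the interior of \<open>K\<close>. Along a billiard
  trajectory \<open>p\<close> moves only in outer normal directions and is periodic, so \<open>0\<close> is a convex
  combination of outer normals at boundary points of the trajectory; by Caratheodory \<open>n + 1\<close> of
  these points already form a pinned polygon, which is not longer than the trajectory. Conversely, a
  shortest pinned polygon with \<open>n + 1\<close> vertices exists by compactness, fits into \<open>K\<close> after a
  translation, and the first order conditions at the minimum are the reflection law; hence it is a
  periodic billiard trajectory and \<open>\<xi>(K)\<close> is its length (Bezdek and Bezdek). Finally, for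
  \<open>r > inrad K\<close>, Helly's theorem gives a pinned polygon with \<open>n + 1\<close> vertices in a ball of radius
  \<open>r\<close>; its sides have length at most \<open>2 r\<close>.
\<close>

section \<open>The gauge of a convex body with differentiable boundary\<close>

text \<open>\<open>xi\<close> is a \<open>LEAST\<close>, so a single short trajectory proves
  nothing: the minimum has to be attained, and all trajectories, gliding ones included, have to be
  measured against the same polygon. Pinnedness suits this because it is translation invariant and,
  being tested against the interior, a closed condition on the vertices. Caratheodory and Helly give
  the same number \<open>n + 1\<close>, so both directions can use polygons with
  \<open>n + 1\<close> vertices, repetitions allowed.

  The obstacle is that a shortest polygon may have coinciding consecutive vertices. There the
  perimeter is not differentiable and a side has no direction from which to read off a momentum. The
  first order conditions are therefore stated as a linear lower bound for the perimeters of all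
  closed polygons, exact at the shortest one. By duality this bound supplies momenta of norm at most
  1 everywhere; they are forced to be unit vectors only on genuine sides, and a side of length zero
  takes no time.\<close>

locale billiard_table =
  fixes K :: "'a::euclidean_space set"
  assumes compact_table: "compact K"
    and convex_table: "convex K"
    and zero_interior: "0 \<in> interior K"
    and differentiable_boundary:
      "x \<in> frontier K \<Longrightarrow> \<exists>U (F :: 'a \<Rightarrow> real) F'. open U \<and> x \<in> U \<and>
         (F has_derivative F') (at x) \<and> F' \<noteq> (\<lambda>_. 0) \<and> frontier K \<inter> U = {y\<in>U. F y = 0}"
begin

abbreviation g :: "'a \<Rightarrow> real" where "g \<equiv> minkowski_gauge K"

abbreviation nrm :: "'a \<Rightarrow> 'a" where "nrm \<equiv> gradient (minkowski_gauge K)"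

section \<open>Gauge of a convex body: sublinearity, continuity and sublevel sets\<close>

lemma closed_table: "closed K"
  using compact_table by (rule compact_imp_closed)

lemma zero_table: "0 \<in> K"
  using zero_interior interior_subset by blast

lemma gauge_set_eq: "{r. r > 0 \<and> q \<in> (*\<^sub>R) r ` K} = {r. r > 0 \<and> (1 / r) *\<^sub>R q \<in> K}"
proof -
  have "q \<in> (*\<^sub>R) r ` K \<longleftrightarrow> (1 / r) *\<^sub>R q \<in> K" if "r > 0" for r
  proof
    assume "(1 / r) *\<^sub>R q \<in> K"
    then show "q \<in> (*\<^sub>R) r ` K"
      using that by (intro image_eqI[of _ _ "(1 / r) *\<^sub>R q"]) auto
  qed (use that in auto)
  then show ?thesis by blast
qed

lemma scaled_in_table: "q \<in> K \<Longrightarrow> 0 \<le> s \<Longrightarrow> s \<le> 1 \<Longrightarrow> s *\<^sub>R q \<in> K"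
  using convexD_alt[OF convex_table zero_table, of q s] by simp

lemma obtain_ball: obtains \<delta> where "\<delta> > 0" "cball 0 \<delta> \<subseteq> K"
  using zero_interior by (meson mem_interior_cball)

text \<open>Closedness of \<open>K\<close> makes the infimum attained: scales \<open>r' > r\<close>
  work because \<open>K\<close> is star-shaped about 0, and letting \<open>r'\<close> decrease to
  \<open>r\<close> stays in \<open>K\<close>. Nearly all later facts about \<open>g\<close> rest on
  this equivalence.\<close>

lemma gauge_le_iff:
  assumes "r > 0"
  shows "g q \<le> r \<longleftrightarrow> (1 / r) *\<^sub>R q \<in> K"
proof
  let ?S = "{r. r > 0 \<and> (1 / r) *\<^sub>R q \<in> K}"
  have bdd: "bdd_below ?S" by (rule bdd_belowI[of _ 0]) auto
  show "(1 / r) *\<^sub>R q \<in> K \<Longrightarrow> g q \<le> r"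
    unfolding minkowski_gauge_def gauge_set_eq using assms bdd by (intro cInf_lower) auto
  assume le: "g q \<le> r"
  obtain \<delta> where \<delta>: "\<delta> > 0" "cball 0 \<delta> \<subseteq> K" by (rule obtain_ball)
  \<comment> \<open>Some scale is admissible, so the infimum is not over the empty set. The
    \<open>+ 1\<close> keeps the scale positive at \<open>q = 0\<close>.\<close>
  have "(norm q + 1) / \<delta> \<in> ?S"
  proof -
    have "norm ((1 / ((norm q + 1) / \<delta>)) *\<^sub>R q) \<le> \<delta>"
      using \<delta>(1) norm_ge_zero[of q] by (auto simp: divide_simps mult_left_mono simp del: norm_ge_zero)
    then have "(1 / ((norm q + 1) / \<delta>)) *\<^sub>R q \<in> K" using \<delta>(2) by auto
    then show ?thesis using \<delta>(1) by (simp add: add_nonneg_pos)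
  qed
  then have ne: "?S \<noteq> {}" by blast
  have step: "(1 / r') *\<^sub>R q \<in> K" if "r' > r" for r'
  proof -
    have "Inf ?S < r'" using le that by (simp add: minkowski_gauge_def gauge_set_eq)
    then obtain s where s: "s > 0" "(1 / s) *\<^sub>R q \<in> K" "s < r'"
      using ne bdd by (auto simp: cInf_less_iff)
    from scaled_in_table[OF s(2), of "s / r'"] s show ?thesis by simp
  qed
  have lim: "(\<lambda>n. (1 / (r + 1 / real (Suc n))) *\<^sub>R q) \<longlonglongrightarrow> (1 / (r + 0)) *\<^sub>R q"
    using assms by (intro tendsto_intros lim_1_over_n[THEN LIMSEQ_Suc]) auto
  have "(1 / (r + 0)) *\<^sub>R q \<in> K"
    by (rule closed_sequentially[OF closed_table _ lim]) (auto intro: step)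
  then show "(1 / r) *\<^sub>R q \<in> K" by simp
qed

lemma gauge_le_one_iff: "g q \<le> 1 \<longleftrightarrow> q \<in> K"
  using gauge_le_iff[of 1 q] by simp

lemma gauge_nonneg: "0 \<le> g q"
proof (rule ccontr)
  assume "\<not> 0 \<le> g q"
  then have neg: "g q < 0" by simp
  have "{r. r > 0 \<and> (1 / r) *\<^sub>R q \<in> K} \<noteq> {}"
  proof -
    have "(1 / max 1 (g q)) *\<^sub>R q \<in> K" using gauge_le_iff[of "max 1 (g q)" q] by auto
    then show ?thesis by (auto intro!: exI[of _ "max 1 (g q)"])
  qed
  then have "0 \<le> g q"
    unfolding minkowski_gauge_def gauge_set_eq by (intro cInf_greatest) auto
  with neg show False by simp
qed

lemma gauge_zero: "g 0 = 0"
proof -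
  have "g 0 \<le> e" if "e > 0" for e using gauge_le_iff[OF that, of 0] zero_table by simp
  then have "g 0 \<le> 0" by - (rule field_le_epsilon, simp)
  then show ?thesis using gauge_nonneg[of 0] by simp
qed

lemma gauge_pos:
  assumes "q \<noteq> 0" shows "0 < g q"
proof (rule ccontr)
  assume "\<not> 0 < g q"
  then have "g q \<le> r" if "r > 0" for r using that by simp
  then have in_K: "(1 / r) *\<^sub>R q \<in> K" if "r > 0" for r using that gauge_le_iff by blast
  obtain B where B: "B > 0" "\<And>x. x \<in> K \<Longrightarrow> norm x \<le> B"
    using compact_imp_bounded[OF compact_table] bounded_pos by metis
  define r where "r = norm q / (2 * B)"
  have "r > 0" using assms B by (simp add: r_def)
  from B(2)[OF in_K[OF this]] show False using assms B(1) by (simp add: r_def)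
qed

lemma gauge_scale:
  assumes "s > 0" shows "g (s *\<^sub>R q) = s * g q"
proof -
  have *: "g (s *\<^sub>R q) \<le> r \<longleftrightarrow> s * g q \<le> r" if "r > 0" for r
  proof -
    have "g (s *\<^sub>R q) \<le> r \<longleftrightarrow> g q \<le> r / s"
      using gauge_le_iff[of r "s *\<^sub>R q"] gauge_le_iff[of "r / s" q] that assms by simp
    then show ?thesis using assms by (simp add: field_simps)
  qed
  show ?thesis
  proof (cases "q = 0")
    case False
    then have "g (s *\<^sub>R q) > 0" "s * g q > 0" using gauge_pos assms by auto
    with * show ?thesis by (meson antisym order_refl)
  qed (simp add: gauge_zero)
qed

text \<open>With \<open>a > g p\<close> and \<open>b > g q\<close>, the point
  \<open>(p + q) / (a + b)\<close> is a convex combination of \<open>p / a\<close> and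
  \<open>q / b\<close>; the slack \<open>e / 2\<close> keeps both scales positive.\<close>

lemma gauge_triangle: "g (p + q) \<le> g p + g q"
proof (rule field_le_epsilon)
  fix e :: real assume e: "e > 0"
  define a b where "a = g p + e / 2" and "b = g q + e / 2"
  have ab: "a > 0" "b > 0" using gauge_nonneg[of p] gauge_nonneg[of q] e by (auto simp: a_def b_def)
  have "(1 / a) *\<^sub>R p \<in> K" "(1 / b) *\<^sub>R q \<in> K"
    using gauge_le_iff[OF ab(1), of p] gauge_le_iff[OF ab(2), of q] e
    by (simp_all add: a_def b_def)
  from convexD[OF convex_table this, of "a / (a + b)" "b / (a + b)"]
  have "(1 / (a + b)) *\<^sub>R (p + q) \<in> K"
    using ab by (simp add: scaleR_add_right flip: add_divide_distrib)
  then show "g (p + q) \<le> g p + g q + e"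
    using gauge_le_iff[of "a + b" "p + q"] ab by (simp add: a_def b_def)
qed

lemma gauge_lipschitz:
  obtains C where "C > 0" "\<And>x y. \<bar>g x - g y\<bar> \<le> C * norm (x - y)"
proof -
  obtain \<delta> where \<delta>: "\<delta> > 0" "cball 0 \<delta> \<subseteq> K" by (rule obtain_ball)
  have le: "g x \<le> norm x / \<delta>" for x
  proof (cases "x = 0")
    case False
    then have "(1 / (norm x / \<delta>)) *\<^sub>R x \<in> cball 0 \<delta>" using \<delta> by simp
    then show ?thesis using gauge_le_iff[of "norm x / \<delta>" x] \<delta> False by auto
  qed (simp add: gauge_zero)
  have "\<bar>g x - g y\<bar> \<le> 1 / \<delta> * norm (x - y)" for x y
    using gauge_triangle[of y "x - y"] gauge_triangle[of x "y - x"] le[of "x - y"] le[of "y - x"]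
    by (simp add: norm_minus_commute)
  then show ?thesis using that[of "1 / \<delta>"] \<delta>(1) by simp
qed

lemma continuous_on_gauge: "continuous_on A g"
proof -
  obtain C where C: "C > 0" "\<And>x y. \<bar>g x - g y\<bar> \<le> C * norm (x - y)" by (rule gauge_lipschitz) auto
  show ?thesis
  proof (rule continuous_on_subset[OF _ subset_UNIV], rule uniformly_continuous_imp_continuous,
      unfold uniformly_continuous_on_def, intro allI impI)
    fix e :: real assume "e > 0"
    then show "\<exists>d>0. \<forall>x\<in>UNIV. \<forall>x'\<in>UNIV. dist x' x < d \<longrightarrow> dist (g x') (g x) < e"
      using C by (intro exI[of _ "e / C"])
        (auto simp: dist_norm field_simps intro: le_less_trans)
  qed
qed

lemma interior_table_iff: "q \<in> interior K \<longleftrightarrow> g q < 1"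
proof
  have "open {x. g x < 1}"
    by (rule open_Collect_less) (auto intro: continuous_on_gauge)
  moreover have "{x. g x < 1} \<subseteq> K" by (auto simp flip: gauge_le_one_iff)
  ultimately show "g q < 1 \<Longrightarrow> q \<in> interior K" by (meson interiorI mem_Collect_eq)
  assume "q \<in> interior K"
  then obtain e where e: "e > 0" "cball q e \<subseteq> K" by (meson mem_interior_cball)
  show "g q < 1"
  proof (cases "q = 0")
    case False
    \<comment> \<open>The point at distance \<open>e\<close> beyond \<open>q\<close> on its ray is
      still in \<open>K\<close>, and \<open>s > 1\<close>.\<close>
    define s where "s = 1 + e / norm q"
    have "dist q (s *\<^sub>R q) = e" using False e(1) by (simp add: s_def dist_norm algebra_simps)
    then have "s *\<^sub>R q \<in> K" using e(2) by auto
    moreover have "s > 0" using False e(1) by (simp add: s_def add_pos_pos)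
    ultimately have "s * g q \<le> 1"
      using gauge_scale[of s q] gauge_le_one_iff[of "s *\<^sub>R q"] by simp
    moreover have "g q < s * g q" using gauge_pos[OF False] e(1) False by (simp add: s_def)
    ultimately show ?thesis by simp
  qed (simp add: gauge_zero)
qed

lemma frontier_table_iff: "q \<in> frontier K \<longleftrightarrow> g q = 1"
  using interior_table_iff[of q] gauge_le_one_iff[of q] closed_table
  by (auto simp: frontier_def closure_closed)

text \<open>Near a boundary point \<open>q\<close> the defining function vanishes at \<open>x / g x\<close>, so its linear part
  satisfies \<open>F' x - g x * F' q = o(norm (x - q))\<close>. This yields both \<open>F' q \<noteq> 0\<close> and the
  derivative of the gauge.\<close>

lemma gauge_gradient_exists:
  assumes q: "q \<in> frontier K"
  shows "\<exists>D. GDERIV g q :> D \<and> D \<bullet> q = 1"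
proof -
  obtain U F F' where U: "open U" "q \<in> U" and F: "(F has_derivative F') (at q)"
    and nz: "F' \<noteq> (\<lambda>_. 0)" and eq: "frontier K \<inter> U = {y\<in>U. F y = (0::real)}"
    using differentiable_boundary[OF q] by blast
  have lin: "linear F'" using F by (simp add: has_derivative_bounded_linear bounded_linear.linear)
  have gq: "g q = 1" using q frontier_table_iff by simp
  have Fq: "F q = 0" using eq q U by blast
  obtain C where C: "C > 0" "\<And>x y. \<bar>g x - g y\<bar> \<le> C * norm (x - y)" by (rule gauge_lipschitz) auto
  define M where "M = 1 + norm q * C"
  have M: "M > 0" using C by (simp add: M_def add_pos_nonneg)
  have key: "\<exists>d>0. \<forall>x. norm (x - q) < d \<longrightarrow> \<bar>F' x - g x * F' q\<bar> \<le> e * norm (x - q)" if e: "e > 0" for e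
  proof -
    obtain d1 where d1: "d1 > 0"
      "\<And>y. norm (y - q) < d1 \<Longrightarrow> norm (F y - F q - F' (y - q)) \<le> e / M * norm (y - q)"
      using F e M unfolding has_derivative_at_alt by (meson divide_pos_pos)
    obtain d2 where d2: "d2 > 0" "\<And>y. norm (y - q) < d2 \<Longrightarrow> y \<in> U"
      using U unfolding open_dist dist_norm by meson
    \<comment> \<open>The first bound gives \<open>g x > 1 / 2\<close>. Then the radial projection
      \<open>y\<close> of \<open>x\<close> to the boundary satisfies
      \<open>norm (y - q) \<le> 2 * M * norm (x - q)\<close>, which the second bound brings below
      \<open>d1\<close> and \<open>d2\<close>.\<close>
    define d where "d = min (1 / (2 * C)) (min d1 d2 / (2 * M))"
    have "d > 0" using C M d1 d2 by (simp add: d_def)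
    moreover have "\<bar>F' x - g x * F' q\<bar> \<le> e * norm (x - q)" if x: "norm (x - q) < d" for x
    proof -
      have "C * norm (x - q) < 1 / 2" using x C by (simp add: d_def field_simps)
      then have gx: "g x > 1 / 2" using C(2)[of x q] gq by (auto simp: abs_le_iff)
      define y where "y = (1 / g x) *\<^sub>R x"
      have gy: "g y = 1" using gauge_scale[of "1 / g x" x] gx by (simp add: y_def)
      have xy: "x = g x *\<^sub>R y" using gx by (simp add: y_def)
      have "g x * norm (y - q) = norm (g x *\<^sub>R (y - q))" using gx by simp
      also have "g x *\<^sub>R (y - q) = (x - q) + (1 - g x) *\<^sub>R q"
        using xy by (simp add: algebra_simps)
      also have "norm \<dots> \<le> norm (x - q) + \<bar>1 - g x\<bar> * norm q" by (metis norm_scaleR norm_triangle_ineq)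
      also have "\<dots> \<le> M * norm (x - q)"
        using mult_right_mono[OF C(2)[of q x], of "norm q"] gq
        by (simp add: M_def algebra_simps norm_minus_commute)
      finally have bd: "g x * norm (y - q) \<le> M * norm (x - q)" .
      have "norm (y - q) / 2 \<le> g x * norm (y - q)"
        using mult_right_mono[of "1/2" "g x" "norm (y - q)"] gx by simp
      with bd have "norm (y - q) \<le> 2 * M * norm (x - q)" by simp
      also have "\<dots> < min d1 d2" using x M by (simp add: d_def field_simps)
      finally have yd: "norm (y - q) < d1" "norm (y - q) < d2" by auto
      have "F y = 0" using eq d2(2)[OF yd(2)] gy frontier_table_iff by auto
      then have "\<bar>F' (y - q)\<bar> \<le> e / M * norm (y - q)" using d1(2)[OF yd(1)] Fq by simp
      then have "g x * \<bar>F' (y - q)\<bar> \<le> e / M * (g x * norm (y - q))"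
        using mult_left_mono[of _ _ "g x"] gx by (fastforce simp: mult.left_commute)
      also have "\<dots> \<le> e / M * (M * norm (x - q))"
        using bd e M by (intro mult_left_mono) auto
      finally have "g x * \<bar>F' (y - q)\<bar> \<le> e * norm (x - q)" using M by simp
      moreover have "F' x - g x * F' q = g x * F' (y - q)"
      proof -
        have "F' x = g x * F' y" using xy linear_scale[OF lin, of "g x" y] by simp
        then show ?thesis by (simp add: linear_diff[OF lin] algebra_simps)
      qed
      ultimately show ?thesis using gx by (simp add: abs_mult)
    qed
    ultimately show ?thesis by blast
  qed
  have Fq_nz: "F' q \<noteq> 0"
  proof
    assume 0: "F' q = 0"
    have "F' w = 0" for w
    proof (cases "w = 0")
      case False
      have "\<bar>F' w\<bar> \<le> e * norm w" if "e > 0" for e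
      proof -
        obtain d where d: "d > 0" "\<And>x. norm (x - q) < d \<Longrightarrow> \<bar>F' x - g x * F' q\<bar> \<le> e * norm (x - q)"
          using key[OF \<open>e > 0\<close>] by blast
        define s where "s = d / (2 * norm w)"
        have s: "s > 0" using d False by (simp add: s_def)
        have "norm (q + s *\<^sub>R w - q) < d" using d False by (simp add: s_def)
        from d(2)[OF this] have "\<bar>F' (q + s *\<^sub>R w)\<bar> \<le> e * (s * norm w)" using 0 s by simp
        then have "s * \<bar>F' w\<bar> \<le> s * (e * norm w)"
          using 0 s by (simp add: linear_add[OF lin] linear_scale[OF lin] abs_mult mult_ac)
        then show ?thesis using s by simp
      qed
      then have "\<bar>F' w\<bar> \<le> e" if "e > 0" for e
        using False that by (metis divide_pos_pos nonzero_divide_eq_eq norm_eq_zero zero_less_norm_iff)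
      then have "\<bar>F' w\<bar> \<le> 0" by - (rule field_le_epsilon, simp)
      then show ?thesis by simp
    qed (simp add: linear_0[OF lin])
    with nz show False by blast
  qed
  define D where "D = (1 / F' q) *\<^sub>R adjoint F' 1"
  have D: "h \<bullet> D = F' h / F' q" for h
    using adjoint_works[OF lin, of h 1] by (simp add: D_def)
  have "(g has_derivative (\<lambda>h. h \<bullet> D)) (at q)"
    unfolding has_derivative_at_alt
  proof (intro conjI allI impI)
    show "bounded_linear (\<lambda>h. h \<bullet> D)" by (rule bounded_linear_inner_left)
    fix e :: real assume e: "e > 0"
    obtain d where d: "d > 0"
      "\<And>x. norm (x - q) < d \<Longrightarrow> \<bar>F' x - g x * F' q\<bar> \<le> (e * \<bar>F' q\<bar>) * norm (x - q)"
      using key[of "e * \<bar>F' q\<bar>"] e Fq_nz by auto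
    have "norm (g y - g q - (y - q) \<bullet> D) \<le> e * norm (y - q)" if "norm (y - q) < d" for y
    proof -
      have "g y - g q - (y - q) \<bullet> D = - (F' y - g y * F' q) / F' q"
        using Fq_nz gq by (simp add: D linear_diff[OF lin] field_simps)
      then have "norm (g y - g q - (y - q) \<bullet> D) = \<bar>F' y - g y * F' q\<bar> / \<bar>F' q\<bar>"
        by (simp add: abs_minus_commute)
      also have "\<dots> \<le> e * norm (y - q)" using d(2)[OF that] Fq_nz by (simp add: field_simps)
      finally show ?thesis .
    qed
    then show "\<exists>d>0. \<forall>y. norm (y - q) < d \<longrightarrow> norm (g y - g q - (y - q) \<bullet> D) \<le> e * norm (y - q)"
      using d(1) by blast
  qed
  moreover have "D \<bullet> q = 1" using D[of q] Fq_nz by (simp add: inner_commute)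
  ultimately show ?thesis by (auto simp: gderiv_def)
qed

lemma
  assumes q: "q \<in> frontier K"
  shows gauge_GDERIV: "GDERIV g q :> nrm q" and nrm_inner_self: "nrm q \<bullet> q = 1"
proof -
  obtain D where D: "GDERIV g q :> D" "D \<bullet> q = 1" using gauge_gradient_exists[OF q] by blast
  have "nrm q = D"
    unfolding gradient_def
  proof (rule the_equality)
    fix E assume "GDERIV g q :> E"
    then have "(\<lambda>h. h \<bullet> E) = (\<lambda>h. h \<bullet> D)" using D(1) has_derivative_unique unfolding gderiv_def by blast
    then show "E = D" by (metis vector_eq_ldot inner_commute)
  qed (fact D(1))
  with D show "GDERIV g q :> nrm q" "nrm q \<bullet> q = 1" by auto
qed

section \<open>First order behaviour at the boundary: supporting half-spaces and inward
  directions\<close>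

lemma gauge_directional_limit:
  assumes "q \<in> frontier K"
  shows "((\<lambda>s. (g (q + s *\<^sub>R w) - 1) / s) \<longlongrightarrow> nrm q \<bullet> w) (at_right 0)"
proof -
  have "((\<lambda>s. g (q + s *\<^sub>R w)) has_derivative (\<lambda>s. (s *\<^sub>R w) \<bullet> nrm q)) (at 0)"
    by (rule has_derivative_compose[where g = g, of "\<lambda>s. q + s *\<^sub>R w" "\<lambda>s. s *\<^sub>R w"])
      (use gauge_GDERIV[OF assms] in \<open>auto simp: gderiv_def intro!: derivative_eq_intros\<close>)
  then have "((\<lambda>s. g (q + s *\<^sub>R w)) has_field_derivative (nrm q \<bullet> w)) (at 0)"
    by (simp add: has_field_derivative_def inner_commute mult.commute[of "w \<bullet> nrm q"] mult_commute_abs)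
  then have "((\<lambda>s. (g (q + s *\<^sub>R w) - g q) / s) \<longlongrightarrow> nrm q \<bullet> w) (at 0)"
    by (simp add: DERIV_def)
  moreover have "g q = 1" using assms frontier_table_iff by simp
  ultimately show ?thesis by (auto intro: tendsto_within_subset)
qed

text \<open>Subadditivity bounds every difference quotient of \<open>g\<close> at \<open>q\<close>
  in direction \<open>y\<close> by \<open>g y\<close>. Thus \<open>nrm q\<close> is the outer normal
  scaled so that its supporting hyperplane is at level 1.\<close>

lemma nrm_inner_le_gauge:
  assumes "q \<in> frontier K" shows "nrm q \<bullet> y \<le> g y"
proof (rule tendsto_upperbound[OF gauge_directional_limit[OF assms, of y]])
  show "\<forall>\<^sub>F s in at_right 0. (g (q + s *\<^sub>R y) - 1) / s \<le> g y"
    using eventually_at_right_less[of 0]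
  proof eventually_elim
    case (elim s)
    have "g (q + s *\<^sub>R y) \<le> 1 + s * g y"
      using gauge_triangle[of q "s *\<^sub>R y"] gauge_scale[OF elim, of y] assms frontier_table_iff by simp
    then show ?case using elim by (simp add: field_simps)
  qed
qed simp

lemma nrm_inner_interior: "q \<in> frontier K \<Longrightarrow> y \<in> interior K \<Longrightarrow> nrm q \<bullet> y < 1"
  using nrm_inner_le_gauge interior_table_iff by (meson le_less_trans)

text \<open>Link between first order conditions and pinnedness: a direction pointing strictly inward
  at all boundary vertices shifts finitely many points of \<open>K\<close> into the interior at
  once.\<close>

lemma eventually_move_into_interior:
  assumes "q \<in> K" and "q \<in> frontier K \<Longrightarrow> nrm q \<bullet> w < 0"
  shows "\<forall>\<^sub>F s in at_right (0::real). q + s *\<^sub>R w \<in> interior K"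
proof (cases "q \<in> frontier K")
  case True
  have "\<forall>\<^sub>F s in at_right 0. (g (q + s *\<^sub>R w) - 1) / s < 0"
    using order_tendstoD(2)[OF gauge_directional_limit[OF True, of w]] assms(2)[OF True] by blast
  then show ?thesis
    using eventually_at_right_less[of 0]
    by eventually_elim (auto simp: interior_table_iff divide_less_0_iff)
next
  case False
  then have "q \<in> interior K" using assms(1) by (metis DiffI closure_subset frontier_def subsetD)
  have "((\<lambda>s. q + s *\<^sub>R w) \<longlongrightarrow> q + 0 *\<^sub>R w) (at_right 0)" by (intro tendsto_intros)
  then show ?thesis
    using topological_tendstoD[OF _ open_interior[of K]] \<open>q \<in> interior K\<close> by auto
qed

end

section \<open>Periodic billiard trajectories are pinned\<close>

definition perimeter :: "nat \<Rightarrow> (nat \<Rightarrow> 'a::real_normed_vector) \<Rightarrow> real" where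
  "perimeter N X = (\<Sum>i<N. norm (X (Suc i) - X i))"

text \<open>Testing against the interior makes this a closed condition on the vertices. Vertices may
  repeat, so polygons with fewer vertices are included.\<close>

definition pinned_polygon :: "nat \<Rightarrow> 'a::euclidean_space set \<Rightarrow> (nat \<Rightarrow> 'a) \<Rightarrow> bool" where
  "pinned_polygon N K X \<longleftrightarrow> X N = X 0 \<and> (\<nexists>v. \<forall>i<N. X i + v \<in> interior K)"

text \<open>Sampling the loop at the times in \<open>T\<close> and closing up gives an inscribed
  polygon; repeated samples bring the number of vertices to exactly \<open>N\<close>.\<close>

lemma loop_length_ge_perimeter:
  fixes q :: "real \<Rightarrow> 'a::euclidean_space"
  assumes per: "q 1 = q 0" and T: "finite T" "T \<subseteq> {0..1}" "card T \<le> N" and N: "0 < N"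
  obtains X where "X N = X 0" "q ` T \<subseteq> X ` {..<N}" "ereal (perimeter N X) \<le> loop_length q"
proof -
  obtain n where n: "N = Suc n" using N gr0_conv_Suc by blast
  \<comment> \<open>Padding with time 1 keeps the list sorted, since all times are at most
    1.\<close>
  define ts where "ts = sorted_list_of_set T @ replicate (N - card T) (1::real)"
  define X where "X i = (if i < N then q (ts ! i) else q (ts ! 0))" for i
  have len: "length ts = N" using T by (simp add: ts_def)
  have set_ts: "T \<subseteq> set ts" "set ts \<subseteq> {0..1}" using T by (auto simp: ts_def)
  have sorted: "sorted ts" using T by (auto simp: ts_def sorted_append)
  \<comment> \<open>With both endpoints added, the closing side of the polygon is covered by the two
    end pieces, which meet at \<open>q 1 = q 0\<close>.\<close>
  define us where "us = 0 # ts @ [1]"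
  have "sorted us" "set us \<subseteq> {0..1}" using sorted set_ts(2) by (auto simp: us_def sorted_append)
  then have le: "ereal (\<Sum>i<length us - 1. dist (q (us ! i)) (q (us ! Suc i))) \<le> loop_length q"
    unfolding loop_length_def by (intro SUP_upper) auto
  have us: "us ! 0 = 0" "us ! Suc i = ts ! i" "us ! Suc N = 1" "length us - 1 = Suc N" if "i < N" for i
    using that len by (auto simp: us_def nth_append)
  have "perimeter N X = (\<Sum>i<n. dist (q (ts ! i)) (q (ts ! Suc i))) + dist (q (ts ! n)) (q (ts ! 0))"
    by (simp add: perimeter_def n X_def dist_norm norm_minus_commute)
  also have "\<dots> \<le> (\<Sum>i<n. dist (q (ts ! i)) (q (ts ! Suc i))) + (dist (q (ts ! n)) (q 1) + dist (q 0) (q (ts ! 0)))"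
    using dist_triangle[of "q (ts ! n)" "q (ts ! 0)" "q 0"] per by simp
  also have "\<dots> = (\<Sum>i<Suc N. dist (q (us ! i)) (q (us ! Suc i)))"
  proof -
    have "(\<Sum>i<Suc N. dist (q (us ! i)) (q (us ! Suc i)))
        = dist (q (us ! 0)) (q (us ! Suc 0)) + (\<Sum>i<n. dist (q (us ! Suc i)) (q (us ! Suc (Suc i))))
          + dist (q (us ! Suc n)) (q (us ! Suc N))"
      by (subst sum.lessThan_Suc_shift) (simp add: n)
    also have "(\<Sum>i<n. dist (q (us ! Suc i)) (q (us ! Suc (Suc i))))
        = (\<Sum>i<n. dist (q (ts ! i)) (q (ts ! Suc i)))"
      by (rule sum.cong) (simp_all add: us n)
    finally show ?thesis using us(1,3)[OF N] us(2)[of 0] us(2)[of n] by (simp add: n)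
  qed
  finally have "ereal (perimeter N X) \<le> loop_length q"
    using le us(4)[OF N] by (metis ereal_less_eq(3) order_trans)
  moreover have "q ` T \<subseteq> X ` {..<N}"
  proof
    fix y assume "y \<in> q ` T"
    then obtain t where "t \<in> set ts" "y = q t" using set_ts(1) by blast
    then obtain i where "i < N" "ts ! i = t" using len by (metis in_set_conv_nth)
    then show "y \<in> X ` {..<N}" using \<open>y = q t\<close> by (auto simp: X_def intro!: image_eqI[of _ _ i])
  qed
  moreover have "X N = X 0" using N by (simp add: X_def)
  ultimately show ?thesis using that by blast
qed

text \<open>Left and right derivatives may differ, so the usual mean value theorem does not apply.
  Around each point the increment is at most \<open>e\<close> times the length of a short interval;
  bisection makes this global, and \<open>e\<close> is arbitrary.\<close>

lemma one_sided_derivatives_nonpos_imp_le: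
  fixes f :: "real \<Rightarrow> real"
  assumes deriv: "\<And>t F. F \<in> {at_left t, at_right t} \<Longrightarrow> \<exists>l\<le>0. (f has_vector_derivative l) F"
    and "a \<le> b"
  shows "f b \<le> f a"
proof -
  have approx: "f b - f a \<le> e * (b - a)" if e: "e > 0" for e
    using \<open>a \<le> b\<close>
  proof (induction rule: Bolzano[where P = "\<lambda>s t. f t - f s \<le> e * (t - s)"])
    case (trans a b c)
    then show ?case by (simp add: algebra_simps)
  next
    case (local x)
    obtain l r where lr: "l \<le> 0" "(f has_vector_derivative l) (at_left x)"
      "r \<le> 0" "(f has_vector_derivative r) (at_right x)"
      using deriv by (metis insertCI)
    obtain d1 where d1: "d1 > 0"
      "\<And>y. y < x \<Longrightarrow> norm (y - x) < d1 \<Longrightarrow> norm (f y - f x - (y - x) *\<^sub>R l) \<le> e * norm (y - x)"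
      using lr(2) e unfolding has_vector_derivative_def has_derivative_within_alt by (metis lessThan_iff)
    obtain d2 where d2: "d2 > 0"
      "\<And>y. y > x \<Longrightarrow> norm (y - x) < d2 \<Longrightarrow> norm (f y - f x - (y - x) *\<^sub>R r) \<le> e * norm (y - x)"
      using lr(4) e unfolding has_vector_derivative_def has_derivative_within_alt by (metis greaterThan_iff)
    have "f t - f s \<le> e * (t - s)" if "s \<le> x" "x \<le> t" "t - s < min d1 d2" for s t
    proof -
      have "f x - f s \<le> e * (x - s)"
      proof (cases "s = x")
        case False
        have "(s - x) * l \<ge> 0" using that(1) lr(1) by (simp add: mult_nonpos_nonpos)
        then show ?thesis using d1(2)[of s] that False by (simp add: abs_le_iff)
      qed simp
      moreover have "f t - f x \<le> e * (t - x)"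
      proof (cases "t = x")
        case False
        have "(t - x) * r \<le> 0" using that(2) lr(3) by (simp add: mult_nonneg_nonpos)
        then show ?thesis using d2(2)[of t] that False by (simp add: abs_le_iff)
      qed simp
      ultimately show ?thesis by (simp add: algebra_simps)
    qed
    then show ?case using d1(1) d2(1) by (intro exI[of _ "min d1 d2"]) auto
  qed
  show ?thesis
  proof (rule field_le_epsilon)
    fix e :: real assume "e > 0"
    then show "f b \<le> f a + e"
      using approx[of "e / (b - a)"] \<open>a \<le> b\<close> by (cases "a = b") auto
  qed
qed

text \<open>A nonincreasing periodic function is constant. For the product of a fixed vector with
  \<open>p\<close> or \<open>q\<close> this turns a sign condition on velocities into an
  equality.\<close>

lemma loop_one_sided_derivatives_nonpos_imp_zero:
  fixes f :: "real \<Rightarrow> real"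
  assumes per: "\<And>t. f (t + 1) = f t"
    and deriv: "\<And>t F. F \<in> {at_left t, at_right t} \<Longrightarrow> \<exists>l\<le>0. (f has_vector_derivative l) F"
    and F: "F \<in> {at_left t, at_right t}" and l: "(f has_vector_derivative l) F"
  shows "l = 0"
proof -
  have mono: "f b \<le> f a" if "a \<le> b" for a b
    by (rule one_sided_derivatives_nonpos_imp_le[OF _ that]) (rule deriv)
  have "f (a + real n) = f a" for a n
    by (induction n) (use per in \<open>auto simp flip: add.assoc simp: add.commute[of 1]\<close>)
  then have const: "f b = f a" if "a \<le> b" for a b
    using mono[OF that] mono[of b "a + real (nat \<lceil>b - a\<rceil>)"] that
    by (smt (verit) of_nat_ceiling)
  then have "f = (\<lambda>_. f t)" by (metis linear)
  then have "(f has_vector_derivative 0) F" by (metis has_vector_derivative_const)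
  moreover have "at_left t \<noteq> bot" "at_right t \<noteq> bot" by simp_all
  ultimately show ?thesis using F l
    by (metis insert_iff singletonD vector_derivative_unique_within)
qed

lemma gradient_norm_unit:
  fixes p :: "'a::euclidean_space"
  assumes "norm p = 1" shows "gradient norm p = p"
proof -
  have "gradient norm p = sgn p"
    unfolding gradient_def
  proof (rule the_equality)
    show "GDERIV norm p :> sgn p" using assms by (intro GDERIV_norm) auto
    then show "E = sgn p" if "GDERIV norm p :> E" for E
      using that has_derivative_unique unfolding gderiv_def
      by (metis (no_types, lifting) vector_eq_ldot inner_commute)
  qed
  then show ?thesis using assms by (simp add: sgn_div_norm)
qed

section \<open>Balance of the normals along a billiard trajectory\<close>

context billiard_table
begin

text \<open>Merges the cases of the definition, gliding included, into one normal form: a nonzero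
  nonnegative combination of a flight and a momentum change, where a positive coefficient certifies
  that the momentum, respectively the position, is on its boundary.\<close>

lemma billiard_velocity:
  assumes bil: "closed_KB_billiard K \<gamma>" and F: "F \<in> {at_left t, at_right t}"
  obtains \<alpha> \<beta> where "\<alpha> \<ge> 0" "\<beta> \<ge> 0" "\<alpha> > 0 \<or> \<beta> > 0"
    "\<beta> > 0 \<Longrightarrow> fst (\<gamma> t) \<in> frontier K" "\<alpha> > 0 \<Longrightarrow> norm (snd (\<gamma> t)) = 1"
    "((\<lambda>t. fst (\<gamma> t)) has_vector_derivative (- \<alpha>) *\<^sub>R snd (\<gamma> t)) F"
    "((\<lambda>t. snd (\<gamma> t)) has_vector_derivative \<beta> *\<^sub>R nrm (fst (\<gamma> t))) F"
proof -
  have comp: "((\<lambda>t. fst (\<gamma> t)) has_vector_derivative fst v) F"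
    "((\<lambda>t. snd (\<gamma> t)) has_vector_derivative snd v) F" if "(\<gamma> has_vector_derivative v) F" for v
    using bounded_linear.has_vector_derivative[OF bounded_linear_fst that]
      bounded_linear.has_vector_derivative[OF bounded_linear_snd that] by simp_all
  have at: "(\<gamma> has_vector_derivative v) F" if "(\<gamma> has_vector_derivative v) (at t)" for v
    using that F by (auto intro: has_vector_derivative_at_within)
  have "\<exists>d>0. \<forall>t. \<gamma> t \<notin> frontier K \<times> sphere 0 1 \<longrightarrow>
        (\<gamma> t \<in> interior K \<times> sphere 0 1 \<longrightarrow>
           (\<gamma> has_vector_derivative d *\<^sub>R (- gradient norm (snd (\<gamma> t)), 0)) (at t)) \<and>
        (\<gamma> t \<in> frontier K \<times> ball 0 1 \<longrightarrow>
           (\<gamma> has_vector_derivative d *\<^sub>R (0, nrm (fst (\<gamma> t)))) (at t))"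
    using bil unfolding closed_KB_billiard_def by (elim conjE)
  then obtain d where d: "d > 0"
    "\<gamma> t \<in> interior K \<times> sphere 0 1 \<Longrightarrow> \<gamma> t \<notin> frontier K \<times> sphere 0 1 \<Longrightarrow>
       (\<gamma> has_vector_derivative d *\<^sub>R (- gradient norm (snd (\<gamma> t)), 0)) (at t)"
    "\<gamma> t \<in> frontier K \<times> ball 0 1 \<Longrightarrow> \<gamma> t \<notin> frontier K \<times> sphere 0 1 \<Longrightarrow>
       (\<gamma> has_vector_derivative d *\<^sub>R (0, nrm (fst (\<gamma> t)))) (at t)"
    by blast
  have "\<forall>t. \<gamma> t \<in> frontier K \<times> sphere 0 1 \<longrightarrow>
        (\<exists>v \<in> velocity_cone K (\<gamma> t). (\<gamma> has_vector_derivative v) (at_left t)) \<and>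
        (\<exists>v \<in> velocity_cone K (\<gamma> t). (\<gamma> has_vector_derivative v) (at_right t))"
    using bil unfolding closed_KB_billiard_def by (elim conjE)
  then have sides: "\<exists>v \<in> velocity_cone K (\<gamma> t). (\<gamma> has_vector_derivative v) (at_left t)"
      "\<exists>v \<in> velocity_cone K (\<gamma> t). (\<gamma> has_vector_derivative v) (at_right t)"
    if "\<gamma> t \<in> frontier K \<times> sphere 0 1"
    using that by simp_all
  have cone: "\<exists>v \<in> velocity_cone K (\<gamma> t). (\<gamma> has_vector_derivative v) F"
    if "\<gamma> t \<in> frontier K \<times> sphere 0 1"
  proof -
    from F consider "F = at_left t" | "F = at_right t" by blast
    then show ?thesis using sides[OF that] by cases simp_all
  qed
  have "\<gamma> t \<in> frontier (K \<times> cball 0 1)" using bil unfolding closed_KB_billiard_def by blast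
  then have "\<gamma> t \<in> K \<times> cball 0 1" "\<gamma> t \<notin> interior K \<times> ball 0 1"
    using closed_table by (simp_all add: frontier_def closure_closed closed_Times interior_Times)
  then have mem: "fst (\<gamma> t) \<in> K" "norm (snd (\<gamma> t)) \<le> 1"
    "fst (\<gamma> t) \<in> interior K \<Longrightarrow> \<not> norm (snd (\<gamma> t)) < 1"
    by (simp_all add: mem_Times_iff)
  have fr: "x \<in> frontier K \<longleftrightarrow> x \<in> K \<and> x \<notin> interior K" for x
    using closed_table by (simp add: frontier_def closure_closed)
  show ?thesis
  proof (cases "norm (snd (\<gamma> t)) = 1")
    case n: True
    show ?thesis
    proof (cases "fst (\<gamma> t) \<in> interior K")
      case True
      then have "\<gamma> t \<in> interior K \<times> sphere 0 1" "\<gamma> t \<notin> frontier K \<times> sphere 0 1"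
        using n by (simp_all add: mem_Times_iff fr)
      from comp[OF at[OF d(2)[OF this]]] show ?thesis
        using that[of d 0] n d(1) by (simp add: gradient_norm_unit)
    next
      case False
      then have f: "fst (\<gamma> t) \<in> frontier K" using mem(1) by (simp add: fr)
      then have "\<gamma> t \<in> frontier K \<times> sphere 0 1" using n by (simp add: mem_Times_iff)
      from cone[OF this] obtain \<alpha> \<beta> where ab: "\<alpha> \<ge> 0" "\<beta> \<ge> 0" "(\<alpha>, \<beta>) \<noteq> (0, 0)"
        "(\<gamma> has_vector_derivative (\<alpha> *\<^sub>R (- gradient norm (snd (\<gamma> t)), 0) + \<beta> *\<^sub>R (0, nrm (fst (\<gamma> t))))) F"
        unfolding velocity_cone_def by blast
      have "\<alpha> > 0 \<or> \<beta> > 0" using ab(1-3) by auto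
      then show ?thesis using that[of \<alpha> \<beta>] ab(1,2) comp[OF ab(4)] f n by (simp add: gradient_norm_unit)
    qed
  next
    case n: False
    then have f: "fst (\<gamma> t) \<in> frontier K" "norm (snd (\<gamma> t)) < 1" using mem by (auto simp: fr)
    then have "\<gamma> t \<in> frontier K \<times> ball 0 1" "\<gamma> t \<notin> frontier K \<times> sphere 0 1"
      by (simp_all add: mem_Times_iff)
    from comp[OF at[OF d(3)[OF this]]] show ?thesis
      using that[of 0 d] f(1) d(1) by simp
  qed
qed

text \<open>If \<open>0\<close> were not in the hull of the normals met while \<open>p\<close> moves, some \<open>w\<close> would have
  nonnegative, somewhere positive, product with all of them, and \<open>w \<bullet> p\<close> could not be periodic.\<close>

lemma billiard_zero_in_normal_hull:
  assumes bil: "closed_KB_billiard K \<gamma>"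
  shows "0 \<in> convex hull (nrm ` (range (\<lambda>t. fst (\<gamma> t)) \<inter> frontier K))"
proof (rule ccontr)
  assume contra: "\<not> ?thesis"
  define q p where "q = (\<lambda>t. fst (\<gamma> t))" and "p = (\<lambda>t. snd (\<gamma> t))"
  \<comment> \<open>Only normals entering some velocity of \<open>p\<close> with a positive
    coefficient are collected: for these a vanishing derivative of \<open>w \<bullet> p\<close>
    forces orthogonality to \<open>w\<close>.\<close>
  define S where "S = {nrm (q t) |t. q t \<in> frontier K \<and>
    (\<exists>\<beta>>0. \<exists>F\<in>{at_left t, at_right t}. (p has_vector_derivative \<beta> *\<^sub>R nrm (q t)) F)}"
  have "\<gamma> (t + 1) = \<gamma> t" for t
    using bil unfolding closed_KB_billiard_def piecewise_smooth_loop_def by blast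
  then have per: "p (t + 1) = p t" "q (t + 1) = q t" for t by (auto simp: p_def q_def)
  have vel: "\<exists>\<alpha> \<beta>. \<alpha> \<ge> 0 \<and> \<beta> \<ge> 0 \<and> (\<alpha> > 0 \<or> \<beta> > 0) \<and> (\<beta> > 0 \<longrightarrow> nrm (q t) \<in> S) \<and> (\<alpha> > 0 \<longrightarrow> norm (p t) = 1) \<and>
     (q has_vector_derivative (- \<alpha>) *\<^sub>R p t) F \<and> (p has_vector_derivative \<beta> *\<^sub>R nrm (q t)) F"
    if F: "F \<in> {at_left t, at_right t}" for t F
  proof (rule billiard_velocity[OF bil F])
    fix \<alpha> \<beta> :: real
    assume ab: "\<alpha> \<ge> 0" "\<beta> \<ge> 0" "\<alpha> > 0 \<or> \<beta> > 0"
      "\<beta> > 0 \<Longrightarrow> fst (\<gamma> t) \<in> frontier K" "\<alpha> > 0 \<Longrightarrow> norm (snd (\<gamma> t)) = 1"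
      "((\<lambda>t. fst (\<gamma> t)) has_vector_derivative (- \<alpha>) *\<^sub>R snd (\<gamma> t)) F"
      "((\<lambda>t. snd (\<gamma> t)) has_vector_derivative \<beta> *\<^sub>R nrm (fst (\<gamma> t))) F"
    have "nrm (q t) \<in> S" if "\<beta> > 0"
      unfolding S_def using that ab(4,7) F unfolding q_def p_def by blast
    then show ?thesis using ab unfolding q_def p_def
      by (intro exI[of _ \<alpha>] exI[of _ \<beta>]) simp
  qed
  have inner_deriv: "((\<lambda>t. w \<bullet> h t) has_vector_derivative w \<bullet> l) F"
    if "(h has_vector_derivative l) F" for w :: 'a and h l and F :: "real filter"
    using bounded_linear.has_vector_derivative[OF bounded_linear_inner_right that] .
  have "S \<subseteq> nrm ` (range q \<inter> frontier K)" unfolding S_def by blast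
  then have 0: "0 \<notin> convex hull S" using contra hull_mono unfolding q_def by blast
  show False
  proof (cases "S = {}")
    \<comment> \<open>If \<open>p\<close> never moved, \<open>q\<close> would run straight on for
      ever: \<open>p 0 \<bullet> q t\<close> would have negative one-sided derivatives everywhere,
      against periodicity.\<close>
    case True
    then have vel': "\<exists>\<alpha>>0. norm (p t) = 1 \<and> (q has_vector_derivative (- \<alpha>) *\<^sub>R p t) F \<and>
      (p has_vector_derivative 0) F" if "F \<in> {at_left t, at_right t}" for t F
      using vel[OF that] by (metis empty_iff order_le_less scaleR_zero_left)
    have const: "w \<bullet> p b = w \<bullet> p a" for w a b
    proof -
      have "w \<bullet> p b \<le> w \<bullet> p a" if "a \<le> b" for a b w
      proof (rule one_sided_derivatives_nonpos_imp_le[OF _ that, of "\<lambda>t. w \<bullet> p t"])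
        fix t :: real and F assume "F \<in> {at_left t, at_right t}"
        then have "(p has_vector_derivative 0) F" using vel' by blast
        from inner_deriv[OF this, of w] show "\<exists>l\<le>0. ((\<lambda>t. w \<bullet> p t) has_vector_derivative l) F"
          by (intro exI[of _ 0]) simp
      qed
      from this[of _ _ w] this[of _ _ "- w"] show ?thesis
        by (smt (verit) inner_minus_left)
    qed
    have p_const: "p t = p 0" for t by (rule vector_eq_ldot[THEN iffD1]) (use const in blast)
    have "\<exists>l<0. ((\<lambda>t. p 0 \<bullet> q t) has_vector_derivative l) F" if "F \<in> {at_left t, at_right t}" for t F
    proof -
      obtain \<alpha> where a: "\<alpha> > 0" "norm (p t) = 1" "(q has_vector_derivative (- \<alpha>) *\<^sub>R p t) F"
        using vel'[OF \<open>F \<in> _\<close>] by blast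
      have "p 0 \<bullet> ((- \<alpha>) *\<^sub>R p t) = - \<alpha>" using a(2) p_const[of t] by (simp add: dot_square_norm)
      then show ?thesis using inner_deriv[OF a(3), of "p 0"] a(1) by (intro exI[of _ "- \<alpha>"]) simp
    qed note neg = this
    obtain l where "l < 0" "((\<lambda>t. p 0 \<bullet> q t) has_vector_derivative l) (at_left 0)"
      using neg[of "at_left 0" 0] by blast
    moreover have "l = 0" if "((\<lambda>t. p 0 \<bullet> q t) has_vector_derivative l) (at_left 0)" for l
      by (rule loop_one_sided_derivatives_nonpos_imp_zero[OF _ _ _ that, of 0])
        (use per in simp, use neg in \<open>blast intro: less_imp_le\<close>, simp)
    ultimately show False by auto
  next
    case False
    \<comment> \<open>The hull need not be closed, so separation is only weak. Taking
      \<open>w\<close> in the span excludes the degenerate case: a \<open>w\<close> orthogonal to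
      \<open>S\<close> would be orthogonal to itself.\<close>
    then obtain w where w: "w \<in> span (convex hull S)" "w \<noteq> 0" "\<And>x. x \<in> convex hull S \<Longrightarrow> 0 \<le> w \<bullet> x"
      using separating_hyperplane_set_0_inspan[OF convex_convex_hull _ 0] convex_hull_eq_empty by blast
    have nonpos: "\<exists>l\<le>0. ((\<lambda>t. (- w) \<bullet> p t) has_vector_derivative l) F"
      if "F \<in> {at_left t, at_right t}" for t F
    proof -
      obtain \<beta> where b: "\<beta> \<ge> 0" "\<beta> > 0 \<longrightarrow> nrm (q t) \<in> S" "(p has_vector_derivative \<beta> *\<^sub>R nrm (q t)) F"
        using vel[OF \<open>F \<in> _\<close>] by blast
      have "w \<bullet> (\<beta> *\<^sub>R nrm (q t)) \<ge> 0"
        using b(1,2) w(3) hull_inc by (cases "\<beta> = 0") (auto simp: hull_inc)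
      then show ?thesis using inner_deriv[OF b(3), of "- w"]
        by (intro exI[of _ "- w \<bullet> (\<beta> *\<^sub>R nrm (q t))"]) simp
    qed
    have orth: "w \<bullet> x = 0" if "x \<in> S" for x
    proof -
      obtain t \<beta> F where t: "x = nrm (q t)" "\<beta> > 0" "F \<in> {at_left t, at_right t}"
        "(p has_vector_derivative \<beta> *\<^sub>R nrm (q t)) F"
        using \<open>x \<in> S\<close> unfolding S_def by blast
      have "- w \<bullet> (\<beta> *\<^sub>R nrm (q t)) = 0"
        by (rule loop_one_sided_derivatives_nonpos_imp_zero[OF _ nonpos t(3) inner_deriv[OF t(4)]])
          (use per in auto)
      then show ?thesis using t(1,2) by simp
    qed
    have "S \<subseteq> {x. w \<bullet> x = 0}" using orth by blast
    then have "convex hull S \<subseteq> {x. w \<bullet> x = 0}" by (intro hull_minimal convex_hyperplane)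
    then have "span (convex hull S) \<subseteq> {x. w \<bullet> x = 0}" by (intro span_minimal subspace_hyperplane)
    then show False using w(1,2) by auto
  qed
qed

text \<open>If a translation by \<open>v\<close> moved all chosen points into the interior, each
  chosen normal \<open>s\<close> would satisfy \<open>s \<bullet> v < 0\<close>, since its product
  is 1 with its own boundary point and below 1 with interior points. A convex combination of these
  normals could not be 0.\<close>

lemma billiard_pinned_polygon:
  assumes bil: "closed_KB_billiard K \<gamma>"
  obtains X where "pinned_polygon (DIM('a) + 1) K X"
    "ereal (perimeter (DIM('a) + 1) X) \<le> loop_length (\<lambda>t. fst (\<gamma> t))"
proof -
  define q where "q = (\<lambda>t. fst (\<gamma> t))"
  have per: "q (t + 1) = q t" for t
    using bil unfolding closed_KB_billiard_def piecewise_smooth_loop_def q_def by simp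
  have per_n: "q (t + real n) = q t" for t n
    by (induction n) (use per in \<open>auto simp flip: add.assoc simp: add.commute[of 1]\<close>)
  have "q (frac t) = q t" for t
  proof (cases "t \<ge> 0")
    case True
    then show ?thesis using per_n[of "frac t" "nat \<lfloor>t\<rfloor>"] by (simp add: frac_def)
  next
    case False
    then show ?thesis using per_n[of t "nat (- \<lfloor>t\<rfloor>)"] by (simp add: frac_def)
  qed
  \<comment> \<open>\<open>loop_length\<close> samples only times in \<open>{0..1}\<close>, so the
    chosen points are moved there by periodicity.\<close>
  then have frac: "\<exists>s\<in>{0..1}. q s = q t" for t
    by (intro bexI[of _ "frac t"]) (auto simp: less_imp_le frac_lt_1)
  obtain S where S: "finite S" "S \<subseteq> nrm ` (range q \<inter> frontier K)" "card S \<le> DIM('a) + 1"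
    "0 \<in> convex hull S"
    using billiard_zero_in_normal_hull[OF bil] unfolding caratheodory[of "nrm ` _"] q_def by blast
  have "\<exists>t\<in>{0..1}. q t \<in> frontier K \<and> nrm (q t) = s" if "s \<in> S" for s
  proof -
    obtain t where "s = nrm (q t)" "q t \<in> frontier K" using subsetD[OF S(2) \<open>s \<in> S\<close>] by blast
    then show ?thesis using frac[of t] by metis
  qed
  then obtain \<tau> where \<tau>: "\<And>s. s \<in> S \<Longrightarrow> \<tau> s \<in> {0..1} \<and> q (\<tau> s) \<in> frontier K \<and> nrm (q (\<tau> s)) = s"
    by metis
  have "card (\<tau> ` S) \<le> DIM('a) + 1" using card_image_le[OF S(1), of \<tau>] S(3) by linarith
  moreover have "\<tau> ` S \<subseteq> {0..1}" using \<tau> by blast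
  ultimately obtain X where X: "X (DIM('a) + 1) = X 0" "q ` \<tau> ` S \<subseteq> X ` {..<DIM('a) + 1}"
    "ereal (perimeter (DIM('a) + 1) X) \<le> loop_length q"
    using loop_length_ge_perimeter[of q "\<tau> ` S" "DIM('a) + 1"] S(1) per[of 0] by auto
  obtain u where u: "\<And>s. s \<in> S \<Longrightarrow> 0 \<le> u s" "sum u S = 1" "(\<Sum>s\<in>S. u s *\<^sub>R s) = 0"
    using S(4) convex_hull_finite[OF S(1)] by auto
  have "\<nexists>v. \<forall>i<DIM('a) + 1. X i + v \<in> interior K"
  proof
    assume "\<exists>v. \<forall>i<DIM('a) + 1. X i + v \<in> interior K"
    then obtain v where v: "\<And>i. i < DIM('a) + 1 \<Longrightarrow> X i + v \<in> interior K" by blast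
    have neg: "s \<bullet> v < 0" if "s \<in> S" for s
    proof -
      have "q (\<tau> s) \<in> X ` {..<DIM('a) + 1}" using X(2) that by blast
      then obtain i where "i < DIM('a) + 1" "X i = q (\<tau> s)" by auto
      with v[of i] nrm_inner_interior[of "q (\<tau> s)"] nrm_inner_self[of "q (\<tau> s)"] \<tau>[OF that]
      show ?thesis by (fastforce simp: inner_add_right)
    qed
    have "(\<Sum>s\<in>S. u s * (s \<bullet> v)) = (\<Sum>s\<in>S. u s *\<^sub>R s) \<bullet> v" by (simp add: inner_sum_left)
    also have "\<dots> = 0" using u(3) by simp
    finally have "(\<Sum>s\<in>S. u s * (- (s \<bullet> v))) = 0" by (simp add: sum_negf)
    then have "\<forall>s\<in>S. u s * (- (s \<bullet> v)) = 0"
      by (subst (asm) sum_nonneg_eq_0_iff) (use S(1) u(1) neg in \<open>auto intro!: mult_nonneg_nonneg simp: less_imp_le mult_nonneg_nonpos\<close>)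
    then have "\<forall>s\<in>S. u s = 0" using neg by fastforce
    then show False using u(2) by simp
  qed
  then show ?thesis using that[of X] X(1,3) unfolding pinned_polygon_def q_def by blast
qed

end

section \<open>Shortest pinned polygons\<close>

lemma perimeter_nonneg: "0 \<le> perimeter N X"
  by (simp add: perimeter_def sum_nonneg)

lemma perimeter_affine: "perimeter N (\<lambda>i. s *\<^sub>R X i + v) = \<bar>s\<bar> * perimeter N X"
  by (simp add: perimeter_def sum_distrib_left flip: scaleR_diff_right)

lemma perimeter_cong: "(\<And>i. i \<le> N \<Longrightarrow> X i = Y i) \<Longrightarrow> perimeter N X = perimeter N Y"
  unfolding perimeter_def by (intro sum.cong) auto

lemma norm_le_perimeter:
  assumes "i \<le> N" shows "norm (X i - X 0) \<le> perimeter N X"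
proof -
  have "X i - X 0 = (\<Sum>j<i. X (Suc j) - X j)" by (simp add: sum_lessThan_telescope)
  also have "norm \<dots> \<le> (\<Sum>j<i. norm (X (Suc j) - X j))" by (rule norm_sum)
  also have "\<dots> \<le> perimeter N X"
    unfolding perimeter_def by (rule sum_mono2) (use assms in auto)
  finally show ?thesis .
qed

lemma pinned_polygon_translate:
  assumes "pinned_polygon N K X" shows "pinned_polygon N K (\<lambda>i. X i + v)"
  using assms unfolding pinned_polygon_def by (auto simp: add.assoc)

lemma pinned_polygon_translate_set:
  "pinned_polygon N ((\<lambda>x. x - c) ` K) X \<longleftrightarrow> pinned_polygon N K X"
proof -
  have "interior ((\<lambda>x. x - c) ` K) = (\<lambda>x. x - c) ` interior K" by (rule interior_translation_subtract)
  then have in_iff: "y \<in> interior ((\<lambda>x. x - c) ` K) \<longleftrightarrow> y + c \<in> interior K" for y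
    by (force simp: image_iff algebra_simps)
  have "(\<exists>v. \<forall>i<N. X i + v + c \<in> interior K) \<longleftrightarrow> (\<exists>v. \<forall>i<N. X i + v \<in> interior K)"
    by (metis add.assoc diff_add_cancel)
  then show ?thesis unfolding pinned_polygon_def in_iff by simp
qed

text \<open>Polygons are whole sequences in the product topology, so compactness is Tychonoff's
  theorem; the entries beyond \<open>N\<close> are normalised to 0.\<close>

lemma shortest_pinned_polygon_exists:
  fixes K :: "'a::euclidean_space set"
  assumes X0: "pinned_polygon N K X0" and N: "0 < N"
  obtains X where "pinned_polygon N K X" "\<And>Y. pinned_polygon N K Y \<Longrightarrow> perimeter N X \<le> perimeter N Y"
proof -
  define L where "L = perimeter N X0"
  define B where "B = PiE UNIV (\<lambda>_::nat. cball (0::'a) L)"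
  \<comment> \<open>Closed: fitting into the interior is a union over \<open>v\<close> of finite
    intersections of open conditions.\<close>
  define T where "T = {X :: nat \<Rightarrow> 'a. X N = X 0} - (\<Union>v. \<Inter>i<N. (\<lambda>X. X i + v) -` interior K)"
  have coord: "continuous_on UNIV (\<lambda>X :: nat \<Rightarrow> 'a. X i)" for i
    by (rule continuous_on_product_coordinates)
  have pinned_iff: "pinned_polygon N K X \<longleftrightarrow> X \<in> T" for X
    by (auto simp: pinned_polygon_def T_def)
  have "compactin (product_topology (\<lambda>_::nat. euclidean :: 'a topology) UNIV) B"
    unfolding B_def compactin_PiE by (simp add: compactin_euclidean_iff)
  then have "compact B" by (simp add: euclidean_product_topology compactin_euclidean_iff)
  moreover have "closed T"
    unfolding T_def
    by (intro closed_Diff closed_Collect_eq coord open_UN open_INT ballI finite_lessThan open_vimage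
        open_interior continuous_on_add continuous_on_const)
  ultimately have "compact (B \<inter> T)" by (rule compact_Int_closed)
  have normalize: "\<exists>X \<in> B \<inter> T. perimeter N X = perimeter N Y" if Y: "pinned_polygon N K Y" "perimeter N Y \<le> L" for Y
  proof
    \<comment> \<open>Once \<open>Y 0\<close> is translated to the origin, every vertex is within
      the perimeter, hence within \<open>L\<close>, of it.\<close>
    let ?X = "\<lambda>i. if i \<le> N then Y i - Y 0 else 0"
    have "norm (Y i - Y 0) \<le> L" if "i \<le> N" for i
      using norm_le_perimeter[OF that, of Y] Y(2) by linarith
    moreover have "0 \<le> L" by (simp add: L_def perimeter_nonneg)
    ultimately have "?X \<in> B" by (auto simp: B_def)
    moreover have "pinned_polygon N K (\<lambda>i. Y i - Y 0)"
      using pinned_polygon_translate[OF Y(1), of "- Y 0"] by simp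
    then have "?X \<in> T" unfolding pinned_iff[symmetric] by (simp add: pinned_polygon_def)
    ultimately show "?X \<in> B \<inter> T" by blast
    have "perimeter N ?X = perimeter N (\<lambda>i. 1 *\<^sub>R Y i + (- Y 0))" by (rule perimeter_cong) simp
    then show "perimeter N ?X = perimeter N Y" by (simp only: perimeter_affine)
  qed
  have "continuous_on (B \<inter> T) (perimeter N)"
    unfolding perimeter_def
    by (intro continuous_on_sum continuous_on_norm continuous_on_diff continuous_on_subset[OF coord subset_UNIV])
  moreover obtain X1 where "X1 \<in> B \<inter> T" "perimeter N X1 = L" using normalize[OF X0] by (auto simp: L_def)
  ultimately obtain X where X: "X \<in> B \<inter> T" "\<And>Y. Y \<in> B \<inter> T \<Longrightarrow> perimeter N X \<le> perimeter N Y"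
    using continuous_attains_inf[OF \<open>compact (B \<inter> T)\<close>] by blast
  have "perimeter N X \<le> perimeter N Y" if "pinned_polygon N K Y" for Y
  proof (cases "perimeter N Y \<le> L")
    case True
    then show ?thesis using normalize[OF that] X(2) by metis
  next
    case False
    then show ?thesis using X(2)[OF \<open>X1 \<in> B \<inter> T\<close>] \<open>perimeter N X1 = L\<close> by linarith
  qed
  then show ?thesis using that[of X] X(1) pinned_iff by blast
qed

text \<open>Several indices may share a value, as vertices with equal normals do. The weights live
  on the image; giving each of them to one chosen preimage transfers them to the indices.\<close>

lemma convex_hull_image_finite:
  assumes I: "finite I" and x: "x \<in> convex hull (f ` I)"
  obtains \<mu> where "\<And>i. i \<in> I \<Longrightarrow> 0 \<le> \<mu> i" "sum \<mu> I = 1" "(\<Sum>i\<in>I. \<mu> i *\<^sub>R f i) = x"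
proof -
  obtain u where u: "\<forall>y\<in>f ` I. 0 \<le> u y" "sum u (f ` I) = 1" "(\<Sum>y\<in>f ` I. u y *\<^sub>R y) = x"
    using x convex_hull_finite[of "f ` I"] I by auto
  define h where "h = inv_into I f"
  define J where "J = h ` f ` I"
  have h: "f (h y) = y" "h y \<in> I" if "y \<in> f ` I" for y
    using that by (simp_all add: h_def f_inv_into_f inv_into_into)
  have inj: "inj_on h (f ` I)" unfolding h_def by (rule inj_on_inv_into) simp
  have J: "J \<subseteq> I" using h by (auto simp: J_def)
  define \<mu> where "\<mu> i = (if i \<in> J then u (f i) else 0)" for i
  have "sum \<mu> I = sum (\<lambda>i. u (f i)) J"
    unfolding \<mu>_def using I J by (subst sum.If_cases) (auto simp: Int_absorb1)
  also have "\<dots> = 1" unfolding J_def using u(2) h by (simp add: sum.reindex[OF inj])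
  finally have 1: "sum \<mu> I = 1" .
  have "(\<Sum>i\<in>I. \<mu> i *\<^sub>R f i) = (\<Sum>i\<in>I. if i \<in> J then u (f i) *\<^sub>R f i else 0)"
    unfolding \<mu>_def by (intro sum.cong) auto
  also have "\<dots> = sum (\<lambda>i. u (f i) *\<^sub>R f i) J"
    using I J by (subst sum.If_cases) (auto simp: Int_absorb1)
  also have "\<dots> = x" unfolding J_def using u(3) h by (simp add: sum.reindex[OF inj])
  finally show ?thesis using that[of \<mu>] 1 u(1) by (auto simp: \<mu>_def)
qed

lemma zero_notin_hull_imp_positive_functional:
  fixes f :: "'i \<Rightarrow> 'a::euclidean_space"
  assumes "finite I" "0 \<notin> convex hull (f ` I)"
  obtains h where "\<And>i. i \<in> I \<Longrightarrow> 0 < h \<bullet> f i"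
proof -
  have "closed (convex hull (f ` I))"
    using assms(1) by (simp add: finite_imp_compact compact_convex_hull compact_imp_closed)
  then obtain h b where "0 < b" "\<forall>x\<in>convex hull (f ` I). h \<bullet> x > b"
    using separating_hyperplane_closed_0[OF convex_convex_hull _ assms(2)] by blast
  then have "0 < h \<bullet> f i" if "i \<in> I" for i
    using hull_inc[OF imageI[OF that, of f], of convex] by (meson less_trans)
  then show ?thesis using that by blast
qed

text \<open>The centre of the smallest ball lies in the hull of the contact points; otherwise some
  direction \<open>h\<close> would bring it closer to all of them and the ball could shrink. That
  the weights vanish off the contact points is what later makes a test polygon computable.\<close>

lemma minimal_enclosing_ball:
  fixes P :: "'i \<Rightarrow> 'a::euclidean_space"
  assumes I: "finite I" "I \<noteq> {}"
  obtains w \<rho> \<nu> where "\<And>i. i \<in> I \<Longrightarrow> norm (P i - w) \<le> \<rho>" "\<And>i. i \<in> I \<Longrightarrow> 0 \<le> \<nu> i"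
    "sum \<nu> I = 1" "(\<Sum>i\<in>I. \<nu> i *\<^sub>R P i) = w" "\<And>i. i \<in> I \<Longrightarrow> \<nu> i \<noteq> 0 \<Longrightarrow> norm (P i - w) = \<rho>"
proof -
  obtain i0 where i0: "i0 \<in> I" using I(2) by blast
  \<comment> \<open>A crude radius about \<open>P i0\<close>: it yields a feasible ball and lets the
    search be confined to a compact set of centres and radii.\<close>
  define R where "R = (\<Sum>i\<in>I. norm (P i - P i0))"
  have R: "norm (P i - P i0) \<le> R" if "i \<in> I" for i
    unfolding R_def using that I(1) by (intro member_le_sum) auto
  define Z where "Z = (\<Inter>i\<in>I. {z. norm (P i - fst z) \<le> snd z}) \<inter> (cball (P i0) R \<times> {0..R})"
  have "closed (\<Inter>i\<in>I. {z :: 'a \<times> real. norm (P i - fst z) \<le> snd z})"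
    by (intro closed_INT ballI closed_Collect_le continuous_intros)
  then have "compact Z"
    unfolding Z_def by (intro closed_Int_compact compact_Times compact_cball compact_Icc)
  have "0 \<le> R" using R[OF i0] norm_ge_zero order_trans by blast
  then have "(P i0, R) \<in> Z" using R by (simp add: Z_def)
  then obtain z where z: "z \<in> Z" "\<And>y. y \<in> Z \<Longrightarrow> snd z \<le> snd y"
    using continuous_attains_inf[OF \<open>compact Z\<close>, of snd] continuous_on_snd[OF continuous_on_id] by (metis empty_iff)
  define w \<rho> where "w = fst z" and "\<rho> = snd z"
  have le: "norm (P i - w) \<le> \<rho>" if "i \<in> I" for i using z(1) that by (simp add: Z_def w_def \<rho>_def)
  have min: "\<rho> \<le> \<rho>'" if "\<And>i. i \<in> I \<Longrightarrow> norm (P i - w') \<le> \<rho>'" for w' \<rho>'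
  proof (cases "\<rho>' \<le> R")
    case True
    have "0 \<le> \<rho>'" using that[OF i0] norm_ge_zero order_trans by blast
    then have "(w', \<rho>') \<in> Z" using that that[OF i0] True by (auto simp: Z_def dist_norm)
    from z(2)[OF this] show ?thesis by (simp add: \<rho>_def)
  next
    case False
    then show ?thesis using z(2)[OF \<open>(P i0, R) \<in> Z\<close>] by (simp add: \<rho>_def)
  qed
  define A where "A = {i \<in> I. norm (P i - w) = \<rho>}"
  have A: "finite A" "A \<subseteq> I" using I by (auto simp: A_def)
  have "0 \<in> convex hull ((\<lambda>i. P i - w) ` A)"
  proof (rule ccontr)
    assume "0 \<notin> convex hull ((\<lambda>i. P i - w) ` A)"
    then obtain h where h: "\<And>i. i \<in> A \<Longrightarrow> 0 < h \<bullet> (P i - w)"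
      using zero_notin_hull_imp_positive_functional[OF A(1)] by blast
    have "\<forall>\<^sub>F s in at_right 0. norm (P i - (w + s *\<^sub>R h)) < \<rho>" if i: "i \<in> I" for i
    \<comment> \<open>Points strictly inside tolerate a small shift of the centre by continuity. For
      contact points the squared distance drops by the first order term
      \<open>2 * s * (h \<bullet> (P i - w))\<close>, which outweighs the second order gain.\<close>
    proof (cases "i \<in> A")
      case False
      then have "norm (P i - (w + 0 *\<^sub>R h)) < \<rho>" using le[OF i] i by (simp add: A_def)
      moreover have "((\<lambda>s. norm (P i - (w + s *\<^sub>R h))) \<longlongrightarrow> norm (P i - (w + 0 *\<^sub>R h))) (at_right 0)"
        by (intro tendsto_intros)
      ultimately show ?thesis by (rule order_tendstoD(2)[rotated])
    next
      case True
      have "((\<lambda>s. s * (h \<bullet> h)) \<longlongrightarrow> 0 * (h \<bullet> h)) (at_right 0)" by (intro tendsto_intros)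
      then have "\<forall>\<^sub>F s in at_right 0. s * (h \<bullet> h) < 2 * (h \<bullet> (P i - w))"
        using h[OF True] by (intro order_tendstoD(2)) auto
      then show ?thesis
        using eventually_at_right_less[of 0]
      proof eventually_elim
        case (elim s)
        have "(norm (P i - (w + s *\<^sub>R h)))\<^sup>2 = (norm (P i - w))\<^sup>2 - s * (2 * (h \<bullet> (P i - w)) - s * (h \<bullet> h))"
          unfolding power2_norm_eq_inner
          by (simp add: inner_diff inner_add inner_commute algebra_simps)
        also have "\<dots> < \<rho>\<^sup>2" using True elim by (simp add: A_def)
        finally show ?case
          by (rule power2_less_imp_less) (use True in \<open>auto simp: A_def\<close>)
      qed
    qed
    then have "\<forall>\<^sub>F s in at_right 0. \<forall>i\<in>I. norm (P i - (w + s *\<^sub>R h)) < \<rho>"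
      using I(1) by (simp add: eventually_ball_finite)
    then obtain s where s: "\<And>i. i \<in> I \<Longrightarrow> norm (P i - (w + s *\<^sub>R h)) < \<rho>"
      using eventually_happens'[OF trivial_limit_at_right_real] by blast
    define m where "m = Max ((\<lambda>i. norm (P i - (w + s *\<^sub>R h))) ` I)"
    have "\<rho> \<le> m" by (rule min[of "w + s *\<^sub>R h"]) (simp add: m_def I)
    moreover have "m < \<rho>" using s I by (simp add: m_def)
    ultimately show False by simp
  qed
  then obtain \<nu> where \<nu>: "\<And>i. i \<in> A \<Longrightarrow> 0 \<le> \<nu> i" "sum \<nu> A = 1" "(\<Sum>i\<in>A. \<nu> i *\<^sub>R (P i - w)) = 0"
    using convex_hull_image_finite[OF A(1)] by blast
  define \<nu>' where "\<nu>' i = (if i \<in> A then \<nu> i else 0)" for i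
  have restrict: "(\<Sum>i\<in>I. \<nu>' i *\<^sub>R F i) = (\<Sum>i\<in>A. \<nu> i *\<^sub>R F i)" for F :: "'i \<Rightarrow> 'b::real_vector"
    by (rule sum.mono_neutral_cong_right) (use A I in \<open>auto simp: \<nu>'_def\<close>)
  show ?thesis
  proof (rule that[of w \<rho> \<nu>'])
    show "sum \<nu>' I = 1" using restrict[of "\<lambda>_. 1::real"] \<nu>(2) by simp
    have "(\<Sum>i\<in>A. \<nu> i *\<^sub>R P i) = (\<Sum>i\<in>A. \<nu> i *\<^sub>R (P i - w)) + sum \<nu> A *\<^sub>R w"
      by (simp add: scaleR_diff_right sum_subtractf scaleR_sum_left)
    then show "(\<Sum>i\<in>I. \<nu>' i *\<^sub>R P i) = w" using restrict[of P] \<nu>(2,3) by simp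
  qed (use le \<nu>(1) in \<open>auto simp: \<nu>'_def A_def split: if_splits\<close>)
qed

section \<open>Momenta from a linear lower bound on the perimeter\<close>

lemma summation_by_parts:
  fixes c Y :: "nat \<Rightarrow> 'a::real_inner"
  shows "(\<Sum>i<k. c i \<bullet> Y i)
    = (\<Sum>j<k. c j) \<bullet> Y k - (\<Sum>i<k. (\<Sum>j<Suc i. c j) \<bullet> (Y (Suc i) - Y i))"
  by (induction k) (simp_all add: inner_add inner_diff algebra_simps)

text \<open>The unit directions of the polygon are sought as \<open>w - (c 0 + \<dots> + c i)\<close> with a common \<open>w\<close>.
  If the enclosing ball of these partial sums had radius larger than \<open>1\<close>, the convex combination of
  extreme points that represents its centre would give a closed polygon violating \<open>bound\<close>.\<close>

lemma reflection_momenta_exist: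
  fixes c X :: "nat \<Rightarrow> 'a::euclidean_space"
  assumes N: "0 < N" and c: "(\<Sum>i<N. c i) = 0"
    and bound: "\<And>Y. Y N = Y 0 \<Longrightarrow> (\<Sum>i<N. c i \<bullet> Y i) \<le> perimeter N Y"
    and X: "X N = X 0" "(\<Sum>i<N. c i \<bullet> X i) = perimeter N X"
  obtains a where "a N = a 0" "\<And>i. i < N \<Longrightarrow> a i - a (Suc i) = c i"
    "\<And>i. i \<le> N \<Longrightarrow> norm (a i) \<le> 1"
    "\<And>i. i < N \<Longrightarrow> a (Suc i) \<bullet> (X (Suc i) - X i) = norm (X (Suc i) - X i)"
proof -
  define P where "P i = (\<Sum>j<Suc i. c j)" for i
  have parts: "(\<Sum>i<N. c i \<bullet> Y i) = - (\<Sum>i<N. P i \<bullet> (Y (Suc i) - Y i))" for Y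
    using summation_by_parts[of c Y N] c by (simp add: P_def)
  obtain w \<rho> \<nu> where w: "\<And>i. i \<in> {..<N} \<Longrightarrow> norm (P i - w) \<le> \<rho>" "\<And>i. i \<in> {..<N} \<Longrightarrow> 0 \<le> \<nu> i"
    "sum \<nu> {..<N} = 1" "(\<Sum>i<N. \<nu> i *\<^sub>R P i) = w" "\<And>i. i \<in> {..<N} \<Longrightarrow> \<nu> i \<noteq> 0 \<Longrightarrow> norm (P i - w) = \<rho>"
    using minimal_enclosing_ball[of "{..<N}" P] N by blast
  have bal: "(\<Sum>i<N. \<nu> i *\<^sub>R (P i - w)) = 0"
    using w(3,4) by (simp add: scaleR_diff_right sum_subtractf flip: scaleR_sum_left)
  have "\<rho> \<le> 1"
  proof -
    \<comment> \<open>Sides of the test polygon. It closes because \<open>w\<close> is the weighted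
      mean of the \<open>P i\<close>; its perimeter is \<open>\<rho>\<close>, while its product with
      \<open>c\<close> is the square of \<open>\<rho>\<close>.\<close>
    define e where "e i = - (\<nu> i *\<^sub>R (P i - w))" for i
    define Y where "Y i = (\<Sum>j<i. e j)" for i
    have Y: "Y N = Y 0" using bal by (simp add: Y_def e_def sum_negf)
    have dY: "Y (Suc i) - Y i = e i" for i by (simp add: Y_def)
    have "perimeter N Y = (\<Sum>i<N. \<nu> i * norm (P i - w))"
      unfolding perimeter_def dY using w(2) by (intro sum.cong) (auto simp: e_def)
    also have "\<dots> = (\<Sum>i<N. \<nu> i * \<rho>)" using w(5) by (intro sum.cong) auto
    also have "\<dots> = \<rho>" using w(3) by (simp flip: sum_distrib_right)
    finally have per: "perimeter N Y = \<rho>" .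
    have "(\<Sum>i<N. c i \<bullet> Y i) = (\<Sum>i<N. \<nu> i * (P i \<bullet> (P i - w)))"
      unfolding parts dY by (simp add: e_def sum_negf)
    also have "\<dots> = (\<Sum>i<N. \<nu> i * ((P i - w) \<bullet> (P i - w))) + w \<bullet> (\<Sum>i<N. \<nu> i *\<^sub>R (P i - w))"
      unfolding inner_sum_right sum.distrib[symmetric]
      by (intro sum.cong) (simp_all add: inner_diff algebra_simps)
    also have "\<dots> = (\<Sum>i<N. \<nu> i * (norm (P i - w))\<^sup>2)"
      using bal by (simp add: power2_norm_eq_inner)
    also have "\<dots> = (\<Sum>i<N. \<nu> i * \<rho>\<^sup>2)" using w(5) by (intro sum.cong) auto
    also have "\<dots> = \<rho>\<^sup>2" using w(3) by (simp flip: sum_distrib_right)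
    finally have "\<rho>\<^sup>2 \<le> \<rho>" using bound[OF Y] per by simp
    then show ?thesis by (cases "\<rho> \<le> 0") (auto simp: power2_eq_square)
  qed
  define a where "a i = w - (\<Sum>j<i. c j)" for i
  have a_Suc: "a (Suc i) = w - P i" for i by (simp add: a_def P_def)
  have norm_Suc: "norm (a (Suc i)) \<le> 1" if "i < N" for i
    using w(1)[of i] that \<open>\<rho> \<le> 1\<close> by (simp add: a_Suc norm_minus_commute)
  have aN: "a N = a 0" using c by (simp add: a_def)
  have "norm (a i) \<le> 1" if "i \<le> N" for i
  proof (cases i)
    case 0
    then show ?thesis using norm_Suc[of "N - 1"] N aN by simp
  qed (use norm_Suc that in auto)
  moreover have "a (Suc i) \<bullet> (X (Suc i) - X i) = norm (X (Suc i) - X i)" if i: "i < N" for i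
  proof -
    let ?d = "\<lambda>i. X (Suc i) - X i"
    have le: "a (Suc i) \<bullet> ?d i \<le> norm (?d i)" if "i < N" for i
      using norm_cauchy_schwarz[of "a (Suc i)" "?d i"] mult_right_mono[OF norm_Suc[OF that], of "norm (?d i)"]
      by simp
    have "(\<Sum>i<N. a (Suc i) \<bullet> ?d i) = w \<bullet> (\<Sum>i<N. ?d i) - (\<Sum>i<N. P i \<bullet> ?d i)"
      unfolding inner_sum_right by (simp only: a_Suc inner_diff_left sum_subtractf)
    also have "(\<Sum>i<N. ?d i) = 0" using X(1) by (simp add: sum_lessThan_telescope)
    \<comment> \<open>The functional equals the perimeter at \<open>X\<close>, so the inequalities
      \<open>le\<close> for the sides, which add up to an equality, are all equalities.\<close>
    finally have "(\<Sum>i<N. norm (?d i) - a (Suc i) \<bullet> ?d i) = 0"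
      using X(2) parts[of X] by (simp add: sum_subtractf perimeter_def)
    then have "\<forall>i\<in>{..<N}. norm (?d i) - a (Suc i) \<bullet> ?d i = 0"
      by (subst (asm) sum_nonneg_eq_0_iff) (use le in auto)
    then show ?thesis using i by simp
  qed
  ultimately show ?thesis using that[of a] aN by (simp add: a_def)
qed

section \<open>First order conditions for a shortest pinned polygon\<close>

context billiard_table
begin

context
  fixes N X
  assumes N: "0 < N" and pinned: "pinned_polygon N K X"
    and shortest: "\<And>Y. pinned_polygon N K Y \<Longrightarrow> perimeter N X \<le> perimeter N Y"
begin

lemma shortest_pinned_perimeter_pos: "0 < perimeter N X"
proof (rule ccontr)
  assume "\<not> 0 < perimeter N X"
  have "X i + - X 0 \<in> interior K" if "i < N" for i
  proof -
    have "norm (X i - X 0) \<le> 0"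
      using norm_le_perimeter[of i N X] that \<open>\<not> 0 < perimeter N X\<close> by linarith
    then show ?thesis using zero_interior by simp
  qed
  then show False using pinned unfolding pinned_polygon_def by blast
qed

text \<open>Scaling by a factor below 1 shortens the polygon, so by minimality the result is not
  pinned and fits into the interior after a translation. These translations are bounded, and a limit
  as the factor tends to 1 works for \<open>X\<close> itself.\<close>

lemma shortest_pinned_translates_into_table: "\<exists>v. \<forall>i\<le>N. X i + v \<in> K"
proof -
  \<comment> \<open>The shift by 2 keeps the factor positive already at
    \<open>k = 0\<close>.\<close>
  define s where "s k = 1 - 1 / real (Suc (Suc k))" for k
  have s: "0 < s k" "s k < 1" for k by (simp_all add: s_def)
  have "\<exists>v. \<forall>i<N. s k *\<^sub>R X i + v \<in> interior K" for k
  proof (rule ccontr)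
    assume "\<not> ?thesis"
    then have "pinned_polygon N K (\<lambda>i. s k *\<^sub>R X i)"
      using pinned unfolding pinned_polygon_def by simp
    from shortest[OF this] have "perimeter N X \<le> s k * perimeter N X"
      using perimeter_affine[of N "s k" X 0] s[of k] by simp
    then show False using shortest_pinned_perimeter_pos s[of k] by simp
  qed
  then obtain v where v: "\<And>k i. i < N \<Longrightarrow> s k *\<^sub>R X i + v k \<in> K"
    using interior_subset by (metis subsetD)
  obtain B where B: "\<And>x. x \<in> K \<Longrightarrow> norm x \<le> B"
    using compact_imp_bounded[OF compact_table] bounded_iff by blast
  have "v k \<in> cball 0 (B + norm (X 0))" for k
  proof -
    have "norm (v k) \<le> norm (s k *\<^sub>R X 0 + v k) + norm (s k *\<^sub>R X 0)"
      by (metis add_diff_cancel_left' norm_triangle_ineq4)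
    moreover have "norm (s k *\<^sub>R X 0) \<le> norm (X 0)" using s[of k] by (simp add: mult_left_le_one_le)
    ultimately show ?thesis using B[OF v[OF N, of k]] by simp
  qed
  then obtain l r where lr: "strict_mono (r :: nat \<Rightarrow> nat)" "(v \<circ> r) \<longlonglongrightarrow> l"
    using compact_cball[of 0 "B + norm (X 0)"] unfolding compact_def by metis
  have "s \<longlonglongrightarrow> 1 - 0"
    unfolding s_def by (intro tendsto_diff tendsto_const lim_1_over_n[THEN LIMSEQ_Suc, THEN LIMSEQ_Suc])
  then have sr: "(s \<circ> r) \<longlonglongrightarrow> 1" using LIMSEQ_subseq_LIMSEQ[OF _ lr(1)] by simp
  have "X i + l \<in> K" if "i < N" for i
  proof -
    have "(\<lambda>k. (s \<circ> r) k *\<^sub>R X i + (v \<circ> r) k) \<longlonglongrightarrow> 1 *\<^sub>R X i + l"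
      by (intro tendsto_intros sr lr(2))
    then have "1 *\<^sub>R X i + l \<in> K"
      by (rule closed_sequentially[OF closed_table, rotated]) (use v[OF that] in simp)
    then show ?thesis by simp
  qed
  moreover have "X N = X 0" using pinned by (simp add: pinned_polygon_def)
  ultimately show ?thesis using N by (metis le_neq_implies_less)
qed

text \<open>The \<open>\<mu> i\<close> are the multipliers of the pinning constraint: if 0 were not
  in the hull of the normals at the boundary vertices, one common direction would move all vertices
  into the interior.\<close>

lemma shortest_pinned_polygon_normals:
  assumes X_in: "\<And>i. i \<le> N \<Longrightarrow> X i \<in> K"
  obtains \<mu> where "\<And>i. i < N \<Longrightarrow> 0 \<le> \<mu> i" "\<And>i. i < N \<Longrightarrow> \<mu> i \<noteq> 0 \<Longrightarrow> X i \<in> frontier K"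
    "sum \<mu> {..<N} = 1" "(\<Sum>i<N. \<mu> i *\<^sub>R nrm (X i)) = 0"
proof -
  define I where "I = {i\<in>{..<N}. X i \<in> frontier K}"
  have "finite I" by (simp add: I_def)
  have "0 \<in> convex hull ((\<lambda>i. nrm (X i)) ` I)"
  proof (rule ccontr)
    assume "\<not> ?thesis"
    then obtain h where h: "\<And>i. i \<in> I \<Longrightarrow> 0 < h \<bullet> nrm (X i)"
      using zero_notin_hull_imp_positive_functional[OF \<open>finite I\<close>] by blast
    have "\<forall>\<^sub>F s in at_right 0. X i + s *\<^sub>R (- h) \<in> interior K" if "i < N" for i
      by (rule eventually_move_into_interior) (use that X_in h[of i] in \<open>auto simp: I_def inner_commute\<close>)
    then have "\<forall>\<^sub>F s in at_right 0. \<forall>i\<in>{..<N}. X i + s *\<^sub>R (- h) \<in> interior K"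
      by (simp add: eventually_ball_finite)
    then obtain s where "\<forall>i\<in>{..<N}. X i + s *\<^sub>R (- h) \<in> interior K"
      using eventually_happens'[OF trivial_limit_at_right_real] by blast
    then show False using pinned unfolding pinned_polygon_def by (metis lessThan_iff)
  qed
  then obtain \<mu> where \<mu>: "\<And>i. i \<in> I \<Longrightarrow> 0 \<le> \<mu> i" "sum \<mu> I = 1" "(\<Sum>i\<in>I. \<mu> i *\<^sub>R nrm (X i)) = 0"
    using convex_hull_image_finite[OF \<open>finite I\<close>] by blast
  define \<mu>' where "\<mu>' i = (if i \<in> I then \<mu> i else 0)" for i
  have restrict: "(\<Sum>i<N. \<mu>' i *\<^sub>R F i) = (\<Sum>i\<in>I. \<mu> i *\<^sub>R F i)" for F :: "nat \<Rightarrow> 'b::real_vector"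
    by (rule sum.mono_neutral_cong_right) (auto simp: \<mu>'_def I_def)
  show ?thesis
    by (rule that[of \<mu>'])
      (use restrict[of "\<lambda>_. 1::real"] restrict[of "\<lambda>i. nrm (X i)"] \<mu> in \<open>auto simp: \<mu>'_def I_def split: if_splits\<close>)
qed

text \<open>Since the normals balance, the weighted sum is invariant under translations of
  \<open>Y\<close>, and it is below 1 if \<open>Y\<close> fits into the interior. So a positive
  value \<open>l\<close> makes \<open>Y / l\<close> pinned, and minimality applies. This replaces
  differentiating the perimeter, which fails at repeated vertices.\<close>

lemma shortest_pinned_polygon_bound:
  assumes \<mu>: "\<And>i. i < N \<Longrightarrow> 0 \<le> \<mu> i" "\<And>i. i < N \<Longrightarrow> \<mu> i \<noteq> 0 \<Longrightarrow> X i \<in> frontier K"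
    "sum \<mu> {..<N} = 1" "(\<Sum>i<N. \<mu> i *\<^sub>R nrm (X i)) = 0"
    and Y: "Y N = Y 0"
  shows "perimeter N X * (\<Sum>i<N. \<mu> i * (nrm (X i) \<bullet> Y i)) \<le> perimeter N Y"
proof -
  define l where "l = (\<Sum>i<N. \<mu> i * (nrm (X i) \<bullet> Y i))"
  show ?thesis
  proof (cases "l \<le> 0")
    case True
    then show ?thesis unfolding l_def[symmetric]
      using perimeter_nonneg[of N X] perimeter_nonneg[of N Y] by (meson mult_nonneg_nonpos order_trans)
  next
    case False
    have "pinned_polygon N K (\<lambda>i. (1 / l) *\<^sub>R Y i)"
      unfolding pinned_polygon_def
    proof (intro conjI notI)
      assume "\<exists>v. \<forall>i<N. (1 / l) *\<^sub>R Y i + v \<in> interior K"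
      then obtain v where v: "\<And>i. i < N \<Longrightarrow> (1 / l) *\<^sub>R Y i + v \<in> interior K" by blast
      let ?f = "\<lambda>i. \<mu> i * (nrm (X i) \<bullet> ((1 / l) *\<^sub>R Y i + v))"
      have "?f i \<le> \<mu> i" "\<mu> i \<noteq> 0 \<Longrightarrow> ?f i < \<mu> i" if "i < N" for i
        using nrm_inner_interior[OF \<mu>(2)[OF that] v[OF that]] \<mu>(1)[OF that]
        by (cases "\<mu> i = 0"; simp add: less_imp_le)+
      \<comment> \<open>Total weight 1 provides an index at which the inequality is strict.\<close>
      moreover obtain j where "j < N" "\<mu> j \<noteq> 0" using \<mu>(3) by (metis lessThan_iff sum.neutral zero_neq_one)
      ultimately have "sum ?f {..<N} < sum \<mu> {..<N}"
        by (intro sum_strict_mono_ex1) auto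
      moreover have "?f i = (1 / l) * (\<mu> i * (nrm (X i) \<bullet> Y i)) + (\<mu> i *\<^sub>R nrm (X i)) \<bullet> v" for i
        by (simp add: inner_add_right algebra_simps)
      then have "sum ?f {..<N} = (1 / l) * l + (\<Sum>i<N. \<mu> i *\<^sub>R nrm (X i)) \<bullet> v"
        by (simp only: sum.distrib sum_distrib_left inner_sum_left l_def)
      ultimately show False using \<mu>(3,4) False by simp
    qed (simp add: Y)
    from shortest[OF this] have "perimeter N X \<le> (1 / l) * perimeter N Y"
      using perimeter_affine[of N "1 / l" Y 0] False by simp
    then show ?thesis using False unfolding l_def[symmetric] by (simp add: field_simps)
  qed
qed

end

end

section \<open>Shortest pinned polygons are billiard trajectories\<close>

lemma smooth_on_affine:
  fixes f :: "real \<Rightarrow> 'a::real_normed_vector"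
  assumes U: "open U" and f: "\<And>x. x \<in> U \<Longrightarrow> f x = a + x *\<^sub>R b"
  shows "smooth_on f U"
proof -
  have "C_k_on k f U" if "\<And>x. x \<in> U \<Longrightarrow> f x = a + x *\<^sub>R b" for k a b and f :: "real \<Rightarrow> 'a"
    using that
  proof (induction k arbitrary: f a b)
    case 0
    have "continuous_on U (\<lambda>x. a + x *\<^sub>R b)" by (intro continuous_intros)
    then show ?case using 0 by (simp cong: continuous_on_cong_simp)
  next
    case (Suc k)
    have deriv: "(f has_derivative (\<lambda>v. v *\<^sub>R b)) (at x)" if "x \<in> U" for x
    proof (rule has_derivative_transform_within_open[OF _ U that])
      show "((\<lambda>x. a + x *\<^sub>R b) has_derivative (\<lambda>v. v *\<^sub>R b)) (at x)"
        by (auto intro!: derivative_eq_intros)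
    qed (simp add: Suc.prems)
    have "C_k_on k (\<lambda>x. frechet_derivative f (at x) v) U" for v
      by (rule Suc.IH[of _ "v *\<^sub>R b" 0]) (use frechet_derivative_at[OF deriv] in \<open>metis add.right_neutral scaleR_zero_right\<close>)
    then show ?case using deriv by (auto simp: differentiable_def)
  qed
  then show ?thesis unfolding smooth_on_def using f by blast
qed

text \<open>\<open>S\<close> plays the role of an arc length function; its increments telescope
  along every partition.\<close>

lemma loop_length_le:
  fixes q :: "real \<Rightarrow> 'a::metric_space"
  assumes q: "\<And>s t. 0 \<le> s \<Longrightarrow> s \<le> t \<Longrightarrow> t \<le> 1 \<Longrightarrow> dist (q s) (q t) \<le> S t - S s"
  shows "loop_length q \<le> ereal (S 1 - S 0)"
  unfolding loop_length_def
proof (rule SUP_least)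
  fix ts :: "real list" assume "ts \<in> {ts. sorted ts \<and> set ts \<subseteq> {0..1}}"
  then have ts: "sorted ts" "set ts \<subseteq> {0..1}" by auto
  have mono: "S s \<le> S t" if "0 \<le> s" "s \<le> t" "t \<le> 1" for s t
    using q[OF that] zero_le_dist[of "q s" "q t"] by linarith
  have "(\<Sum>i<length ts - 1. dist (q (ts ! i)) (q (ts ! Suc i))) \<le> S 1 - S 0"
  proof (cases "ts = []")
    case False
    define n where "n = length ts - 1"
    have len: "length ts = Suc n" using False by (simp add: n_def)
    have in01: "0 \<le> ts ! i" "ts ! i \<le> 1" if "i \<le> n" for i
      using subsetD[OF ts(2) nth_mem[of i ts]] that len by simp_all
    have "(\<Sum>i<n. dist (q (ts ! i)) (q (ts ! Suc i))) \<le> (\<Sum>i<n. S (ts ! Suc i) - S (ts ! i))"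
    proof (rule sum_mono)
      fix i assume "i \<in> {..<n}"
      then show "dist (q (ts ! i)) (q (ts ! Suc i)) \<le> S (ts ! Suc i) - S (ts ! i)"
        using in01 ts(1) len by (intro q) (auto intro: sorted_nth_mono)
    qed
    also have "\<dots> = S (ts ! n) - S (ts ! 0)" by (rule sum_lessThan_telescope)
    also have "\<dots> \<le> S 1 - S 0" using mono in01[of n] in01[of 0] by (intro diff_mono) auto
    finally show ?thesis by (simp add: n_def)
  qed (use mono[of 0 1] in auto)
  then show "ereal (\<Sum>i<length ts - 1. dist (q (ts ! i)) (q (ts ! Suc i))) \<le> ereal (S 1 - S 0)"
    by simp
qed

text \<open>Pieces of duration 0 are allowed, so degenerate sides and vertices without reflection
  need no separate treatment; one-sided derivatives are attributed only to pieces of positive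
  duration. The map \<open>h\<close> is meant for the projection to the position.\<close>

lemma piecewise_linear_loop:
  fixes z V :: "nat \<Rightarrow> 'a::real_normed_vector" and h :: "'a \<Rightarrow> 'b::real_normed_vector"
  assumes \<tau>: "\<And>j. j < M \<Longrightarrow> 0 \<le> \<tau> j" "sum \<tau> {..<M} = (1::real)"
    and step: "\<And>j. j < M \<Longrightarrow> z (Suc j) = z j + \<tau> j *\<^sub>R V j"
    and closed: "z M = z 0" and h: "linear h"
  obtains \<gamma> where "piecewise_smooth_loop \<gamma>"
    "\<And>t F. F \<in> {at_left t, at_right t} \<Longrightarrow> \<exists>j<M. \<exists>s. 0 < \<tau> j \<and> 0 \<le> s \<and> s \<le> \<tau> j \<and>
        \<gamma> t = z j + s *\<^sub>R V j \<and> (\<gamma> has_vector_derivative V j) F"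
    "loop_length (\<lambda>t. h (\<gamma> t)) \<le> ereal (\<Sum>j<M. \<tau> j * norm (h (V j)))"
proof -
  define T where "T j = sum \<tau> {..<j}" for j
  \<comment> \<open>Time spent in piece \<open>j\<close> up to time \<open>t\<close>. Writing the
    curve as a sum over all pieces makes the length estimate a termwise computation.\<close>
  define clamp where "clamp j t = max 0 (min (\<tau> j) (t - T j))" for j t
  define f where "f t = z 0 + (\<Sum>j<M. clamp j t *\<^sub>R V j)" for t
  define \<gamma> where "\<gamma> t = f (frac t)" for t
  have T0: "T 0 = 0" and TM: "T M = 1" using \<tau>(2) by (simp_all add: T_def)
  have T_Suc: "T (Suc j) = T j + \<tau> j" for j by (simp add: T_def)
  have T_mono: "T i \<le> T j" if "i \<le> j" "j \<le> M" for i j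
    unfolding T_def by (rule sum_mono2) (use that \<tau>(1) in auto)
  have z_eq: "z j = z 0 + (\<Sum>i<j. \<tau> i *\<^sub>R V i)" if "j \<le> M" for j
    using that by (induction j) (simp_all add: step add.assoc)
  have f_eq: "f t = z j + (t - T j) *\<^sub>R V j" if j: "j < M" and t: "T j \<le> t" "t \<le> T (Suc j)" for j t
  proof -
    have 1: "clamp i t = \<tau> i" if "i < j" for i
      using T_mono[of "Suc i" j] \<tau>(1)[of i] that j t T_Suc[of i] by (simp add: clamp_def)
    have 2: "clamp j t = t - T j" using t T_Suc[of j] by (simp add: clamp_def)
    have 3: "clamp i t = 0" if "j < i" "i < M" for i
      using T_mono[of "Suc j" i] \<tau>(1)[of i] that j t by (simp add: clamp_def)
    have "(\<Sum>i<M. clamp i t *\<^sub>R V i) = (\<Sum>i<Suc j. clamp i t *\<^sub>R V i)"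
      by (rule sum.mono_neutral_right) (use j 3 in auto)
    also have "\<dots> = (\<Sum>i<j. \<tau> i *\<^sub>R V i) + (t - T j) *\<^sub>R V j" using 1 2 by simp
    finally show ?thesis using z_eq[of j] j by (simp add: f_def)
  qed
  have M: "0 < M" using \<tau>(2) by (cases M) auto
  have f01: "f 1 = f 0"
  proof -
    have "f 1 = z M"
      using f_eq[of "M - 1" 1] step[of "M - 1"] M T_mono[of "M - 1" M] TM T_Suc[of "M - 1"] by simp
    moreover have "f 0 = z 0"
      using f_eq[of 0 0] M T0 T_mono[of 0 "Suc 0"] by simp
    ultimately show ?thesis using closed by simp
  qed
  \<comment> \<open>By \<open>f 1 = f 0\<close> the formula holds at both ends of the period, so it
    serves left and right derivatives alike.\<close>
  have \<gamma>_eq: "\<gamma> t = f (t - of_int n)" if "of_int n \<le> t" "t \<le> of_int n + 1" for t n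
  proof (cases "t = of_int n + 1")
    case True
    then have "frac t = 0" by (simp add: frac_def)
    then show ?thesis using True f01 by (simp add: \<gamma>_def)
  next
    case False
    then have "\<lfloor>t\<rfloor> = n" using that by (intro floor_unique) auto
    then show ?thesis by (simp add: \<gamma>_def frac_def)
  qed
  have piece: "\<gamma> t = z j + (t - of_int n - T j) *\<^sub>R V j"
    if "j < M" "of_int n + T j \<le> t" "t \<le> of_int n + T (Suc j)" for j n t
    using f_eq[of j "t - of_int n"] \<gamma>_eq[of n t] T_mono[of 0 j] T_mono[of "Suc j" M] T0 TM that by simp
  have deriv: "((\<lambda>t. z j + (t - of_int n - T j) *\<^sub>R V j) has_vector_derivative V j) F" for j n F
    unfolding has_vector_derivative_def by (auto intro!: derivative_eq_intros)
  \<comment> \<open>Taking the first piece that ends strictly after \<open>frac t\<close> skips the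
    pieces of duration 0.\<close>
  have right: "\<exists>j<M. \<exists>n. of_int n + T j \<le> t \<and> t < of_int n + T (Suc j)" for t
  proof -
    have "\<exists>j<M. (\<forall>i\<le>j. \<not> frac t < T i) \<and> frac t < T (Suc j)"
      by (rule ex_least_nat_less) (simp_all add: T0 TM frac_lt_1 not_less)
    then obtain j where "j < M" "T j \<le> frac t" "frac t < T (Suc j)" by (auto simp: not_less)
    then show ?thesis by (intro exI[of _ j] conjI exI[of _ "\<lfloor>t\<rfloor>"]) (auto simp: frac_def)
  qed
  have left: "\<exists>j<M. \<exists>n. of_int n + T j < t \<and> t \<le> of_int n + T (Suc j)" for t
  proof -
    \<comment> \<open>Not the floor: the left-hand side of \<open>t\<close> is needed, so
      \<open>t\<close> has to lie in \<open>(n, n + 1]\<close>, and an integer \<open>t\<close>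
      belongs to the end of the preceding period.\<close>
    define n where "n = \<lceil>t\<rceil> - 1"
    have n: "of_int n < t" "t \<le> of_int n + 1" unfolding n_def by linarith+
    have "\<exists>j<M. (\<forall>i\<le>j. \<not> t - of_int n \<le> T i) \<and> t - of_int n \<le> T (Suc j)"
      by (rule ex_least_nat_less) (use n in \<open>simp_all add: T0 TM\<close>)
    then obtain j where "j < M" "T j < t - of_int n" "t - of_int n \<le> T (Suc j)" by (auto simp: not_le)
    then show ?thesis by (intro exI[of _ j] conjI exI[of _ n]) auto
  qed
  have one_sided: "\<exists>j<M. \<exists>s. 0 < \<tau> j \<and> 0 \<le> s \<and> s \<le> \<tau> j \<and>
        \<gamma> t = z j + s *\<^sub>R V j \<and> (\<gamma> has_vector_derivative V j) F"
    if "F \<in> {at_left t, at_right t}" for t F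
  proof -
    from that consider "F = at_right t" | "F = at_left t" by blast
    then show ?thesis
    proof cases
      case 1
      obtain j n where j: "j < M" "of_int n + T j \<le> t" "t < of_int n + T (Suc j)" using right by blast
      define b where "b = (t + (of_int n + T (Suc j))) / 2"
      have b: "t < b" "b \<le> of_int n + T (Suc j)" using j(3) by (simp_all add: b_def)
      have "(\<gamma> has_vector_derivative V j) (at t within {t..b})"
        by (rule has_vector_derivative_transform[OF _ _ deriv[where j = j and n = n]]) (use piece[OF j(1)] j b in auto)
      then have "(\<gamma> has_vector_derivative V j) F" using b(1) 1 by (simp add: at_within_Icc_at_right)
      then show ?thesis using j piece[OF j(1), of n t] T_Suc[of j]
        by (intro exI[of _ j] conjI exI[of _ "t - of_int n - T j"]) auto
    next
      case 2
      obtain j n where j: "j < M" "of_int n + T j < t" "t \<le> of_int n + T (Suc j)" using left by blast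
      define b where "b = (t + (of_int n + T j)) / 2"
      have b: "b < t" "of_int n + T j \<le> b" using j(2) by (simp_all add: b_def)
      have "(\<gamma> has_vector_derivative V j) (at t within {b..t})"
        by (rule has_vector_derivative_transform[OF _ _ deriv[where j = j and n = n]]) (use piece[OF j(1)] j b in auto)
      then have "(\<gamma> has_vector_derivative V j) F" using b(1) 2 by (simp add: at_within_Icc_at_left)
      then show ?thesis using j piece[OF j(1), of n t] T_Suc[of j]
        by (intro exI[of _ j] conjI exI[of _ "t - of_int n - T j"]) auto
    qed
  qed
  have "piecewise_smooth_loop \<gamma>"
    unfolding piecewise_smooth_loop_def
  proof (intro conjI allI)
    show "\<gamma> (t + 1) = \<gamma> t" for t by (simp add: \<gamma>_def frac_1_eq)
    show L: "\<exists>v. (\<gamma> has_vector_derivative v) (at_left t)" for t using one_sided[of "at_left t" t] by blast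
    show R: "\<exists>v. (\<gamma> has_vector_derivative v) (at_right t)" for t using one_sided[of "at_right t" t] by blast
    have "isCont \<gamma> t" for t
      unfolding continuous_at_split using L R has_vector_derivative_continuous by blast
    then show "continuous_on UNIV \<gamma>" by (simp add: continuous_at_imp_continuous_on)
    \<comment> \<open>All breakpoints of all periods; a countable set, hence negligible.\<close>
    define J where "J = (\<lambda>(n::int, j). of_int n + T j) ` (UNIV \<times> UNIV)"
    have "countable J" unfolding J_def by (intro countable_image) simp
    then have "negligible (\<Union>x\<in>J. {x})"
      by (intro negligible_countable_Union) (auto intro: countable_image)
    then have "negligible J" by simp
    moreover have "\<exists>U. open U \<and> t \<in> U \<and> smooth_on \<gamma> U" if t: "t \<notin> J" for t
    proof -
      obtain j n where j: "j < M" "of_int n + T j \<le> t" "t < of_int n + T (Suc j)" using right by blast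
      have "of_int n + T j \<in> J" by (auto simp: J_def)
      then have ne: "t \<noteq> of_int n + T j" using t by blast
      have "smooth_on \<gamma> {of_int n + T j<..<of_int n + T (Suc j)}"
        by (rule smooth_on_affine[of _ _ "z j - (of_int n + T j) *\<^sub>R V j" "V j"])
          (use piece[OF j(1)] in \<open>auto simp: algebra_simps\<close>)
      then show ?thesis using j ne by (intro exI[of _ "{of_int n + T j<..<of_int n + T (Suc j)}"]) auto
    qed
    ultimately show "\<exists>N. negligible N \<and> (\<forall>t. t \<notin> N \<longrightarrow> (\<exists>U. open U \<and> t \<in> U \<and> smooth_on \<gamma> U))"
      by blast
  qed
  moreover have "loop_length (\<lambda>t. h (\<gamma> t)) \<le> ereal (\<Sum>j<M. \<tau> j * norm (h (V j)))"
  proof -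
    define S where "S t = (\<Sum>j<M. clamp j t * norm (h (V j)))" for t
    have hf: "h (f t) = h (z 0) + (\<Sum>j<M. clamp j t *\<^sub>R h (V j))" for t
      by (simp add: f_def linear_add[OF h] linear_sum[OF h] linear_scale[OF h])
    have "dist (h (\<gamma> s)) (h (\<gamma> t)) \<le> S t - S s" if st: "0 \<le> s" "s \<le> t" "t \<le> 1" for s t
    proof -
      have "h (f t) - h (f s) = (\<Sum>j<M. (clamp j t - clamp j s) *\<^sub>R h (V j))"
        by (simp add: hf scaleR_diff_left sum_subtractf)
      also have "norm \<dots> \<le> (\<Sum>j<M. norm ((clamp j t - clamp j s) *\<^sub>R h (V j)))" by (rule norm_sum)
      also have "\<dots> = (\<Sum>j<M. (clamp j t - clamp j s) * norm (h (V j)))"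
        using st(2) by (intro sum.cong) (auto simp: clamp_def)
      also have "\<dots> = S t - S s" by (simp add: S_def left_diff_distrib sum_subtractf)
      finally show ?thesis
        using \<gamma>_eq[of 0 s] \<gamma>_eq[of 0 t] st by (simp add: dist_norm norm_minus_commute)
    qed
    from loop_length_le[OF this] have "loop_length (\<lambda>t. h (\<gamma> t)) \<le> ereal (S 1 - S 0)" .
    also have "S 1 - S 0 = (\<Sum>j<M. \<tau> j * norm (h (V j)))"
    proof -
      have "clamp j 1 = \<tau> j" "clamp j 0 = 0" if "j < M" for j
        using \<tau>(1)[OF that] T_mono[of "Suc j" M] T_mono[of 0 j] that TM T0 T_Suc[of j]
        by (simp_all add: clamp_def)
      then show ?thesis by (simp add: S_def)
    qed
    finally show ?thesis .
  qed
  ultimately show ?thesis using that[of \<gamma>] one_sided by blast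
qed

section \<open>From a polygon with momenta to a billiard trajectory\<close>

context billiard_table
begin

text \<open>It suffices that all one-sided velocities are pure moves. Where a two-sided derivative
  is demanded only one kind of move is possible, so the two one-sided derivatives coincide.\<close>

lemma closed_KB_billiardI:
  assumes loop: "piecewise_smooth_loop \<gamma>" and d: "d > 0"
    and vel: "\<And>t F. F \<in> {at_left t, at_right t} \<Longrightarrow> \<exists>v. (\<gamma> has_vector_derivative v) F \<and>
      (fst (\<gamma> t) \<in> K \<and> norm (snd (\<gamma> t)) = 1 \<and> v = d *\<^sub>R (- snd (\<gamma> t), 0) \<or>
       fst (\<gamma> t) \<in> frontier K \<and> norm (snd (\<gamma> t)) \<le> 1 \<and> v = d *\<^sub>R (0, nrm (fst (\<gamma> t))))"
  shows "closed_KB_billiard K \<gamma>"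
proof -
  have fr: "x \<in> frontier K \<longleftrightarrow> x \<in> K \<and> x \<notin> interior K" for x
    using closed_table by (simp add: frontier_def closure_closed)
  have range: "\<gamma> t \<in> frontier (K \<times> cball 0 1)" for t
  proof -
    have "fst (\<gamma> t) \<in> K" "norm (snd (\<gamma> t)) \<le> 1" "fst (\<gamma> t) \<notin> interior K \<or> norm (snd (\<gamma> t)) = 1"
      using vel[of "at_left t" t] fr by auto
    then show ?thesis
      using closed_table
      by (auto simp: frontier_def closure_closed closed_Times interior_Times mem_Times_iff)
  qed
  have split: "(\<gamma> has_vector_derivative v) (at t)"
    if "(\<gamma> has_vector_derivative v) (at_left t)" "(\<gamma> has_vector_derivative v) (at_right t)" for v t
    using that unfolding has_vector_derivative_def has_derivative_within filterlim_at_split by blast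
  have q_move: "(\<gamma> has_vector_derivative d *\<^sub>R (- gradient norm (snd (\<gamma> t)), 0)) (at t)"
    if "\<gamma> t \<in> interior K \<times> sphere 0 1" for t
  proof (rule split)
    have n: "norm (snd (\<gamma> t)) = 1" "fst (\<gamma> t) \<notin> frontier K" using that by (auto simp: fr mem_Times_iff)
    show "(\<gamma> has_vector_derivative d *\<^sub>R (- gradient norm (snd (\<gamma> t)), 0)) (at_left t)"
      "(\<gamma> has_vector_derivative d *\<^sub>R (- gradient norm (snd (\<gamma> t)), 0)) (at_right t)"
      using vel[of "at_left t" t] vel[of "at_right t" t] n by (auto simp: gradient_norm_unit)
  qed
  have p_move: "(\<gamma> has_vector_derivative d *\<^sub>R (0, nrm (fst (\<gamma> t)))) (at t)"
    if "\<gamma> t \<in> frontier K \<times> ball 0 1" for t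
  proof (rule split)
    have n: "norm (snd (\<gamma> t)) \<noteq> 1" using that by (auto simp: mem_Times_iff)
    show "(\<gamma> has_vector_derivative d *\<^sub>R (0, nrm (fst (\<gamma> t)))) (at_left t)"
      "(\<gamma> has_vector_derivative d *\<^sub>R (0, nrm (fst (\<gamma> t)))) (at_right t)"
      using vel[of "at_left t" t] vel[of "at_right t" t] n by auto
  qed
  have both: "\<exists>v \<in> velocity_cone K (\<gamma> t). (\<gamma> has_vector_derivative v) F"
    if t: "\<gamma> t \<in> frontier K \<times> sphere 0 1" and F: "F \<in> {at_left t, at_right t}" for t F
  proof -
    have n: "norm (snd (\<gamma> t)) = 1" using t by (auto simp: mem_Times_iff)
    have "d *\<^sub>R (- snd (\<gamma> t), 0) \<in> velocity_cone K (\<gamma> t)"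
      unfolding velocity_cone_def
      by (rule CollectI, rule exI[of _ d], rule exI[of _ 0]) (use d in \<open>simp add: gradient_norm_unit[OF n]\<close>)
    moreover have "d *\<^sub>R (0, nrm (fst (\<gamma> t))) \<in> velocity_cone K (\<gamma> t)"
      unfolding velocity_cone_def
      by (rule CollectI, rule exI[of _ 0], rule exI[of _ d]) (use d in simp)
    ultimately show ?thesis using vel[OF F] by blast
  qed
  show ?thesis
    unfolding closed_KB_billiard_def
    using loop range d q_move p_move both by (intro conjI exI[of _ d]) auto
qed

text \<open>Move \<open>2 * i\<close> changes \<open>p\<close> at the vertex \<open>X i\<close>, move \<open>2 * i + 1\<close> runs along the side after it;
  here \<open>p\<close> is minus the direction of motion.\<close>

lemma polygon_billiard:
  assumes X: "X N = X 0" "\<And>i. i \<le> N \<Longrightarrow> X i \<in> K"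
    and a: "a N = a 0" "\<And>i. i \<le> N \<Longrightarrow> norm (a i) \<le> 1"
      "\<And>i. i < N \<Longrightarrow> a i - a (Suc i) = \<sigma> i *\<^sub>R nrm (X i)"
      "\<And>i. i < N \<Longrightarrow> a (Suc i) \<bullet> (X (Suc i) - X i) = norm (X (Suc i) - X i)"
    and \<sigma>: "\<And>i. i < N \<Longrightarrow> 0 \<le> \<sigma> i" "\<And>i. i < N \<Longrightarrow> \<sigma> i \<noteq> 0 \<Longrightarrow> X i \<in> frontier K"
    and pos: "0 < perimeter N X"
  obtains \<gamma> where "closed_KB_billiard K \<gamma>" "loop_length (\<lambda>t. fst (\<gamma> t)) \<le> ereal (perimeter N X)"
proof -
  \<comment> \<open>All velocities are scaled by \<open>d\<close>, so the moves last
    \<open>\<sigma> i / d\<close> and side length over \<open>d\<close>; this choice makes the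
    period 1.\<close>
  define d where "d = sum \<sigma> {..<N} + perimeter N X"
  define z where "z j = (X (j div 2), - a (Suc j div 2))" for j
  define \<tau> where "\<tau> j = (if even j then \<sigma> (j div 2) else norm (X (Suc (j div 2)) - X (j div 2))) / d" for j
  define V where "V j = d *\<^sub>R (if even j then (0, nrm (X (j div 2))) else (a (Suc j div 2), 0))" for j
  have "0 \<le> sum \<sigma> {..<N}" by (rule sum_nonneg) (use \<sigma>(1) in simp)
  then have d: "0 < d" using pos by (simp add: d_def)
  have sum2: "(\<Sum>j<2 * N. F j) = (\<Sum>i<N. F (2 * i)) + (\<Sum>i<N. F (Suc (2 * i)))" for F :: "nat \<Rightarrow> real"
    by (induction N) simp_all
  \<comment> \<open>On a genuine side, equality in Cauchy-Schwarz and norm at most 1 make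
    \<open>a (Suc i)\<close> the unit direction. On a degenerate side its norm may be smaller, which
    is harmless since that move lasts no time.\<close>
  have side: "X (Suc i) - X i = norm (X (Suc i) - X i) *\<^sub>R a (Suc i)"
    and unit: "X (Suc i) \<noteq> X i \<Longrightarrow> norm (a (Suc i)) = 1" if i: "i < N" for i
  proof -
    let ?D = "X (Suc i) - X i"
    have n: "norm (a (Suc i)) \<le> 1" using a(2) i by simp
    have "norm ?D \<le> norm (a (Suc i)) * norm ?D"
      using norm_cauchy_schwarz[of "a (Suc i)" ?D] a(4)[OF i] by simp
    then show u: "norm (a (Suc i)) = 1" if "X (Suc i) \<noteq> X i" using n that by simp
    show "?D = norm ?D *\<^sub>R a (Suc i)"
    proof (cases "X (Suc i) = X i")
      case False
      then have "a (Suc i) \<bullet> ?D = norm (a (Suc i)) * norm ?D" using a(4)[OF i] u by simp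
      then show ?thesis using u[OF False] by (metis norm_cauchy_schwarz_eq scaleR_one)
    qed simp
  qed
  have \<tau>_nonneg: "0 \<le> \<tau> j" if "j < 2 * N" for j
    using that \<sigma>(1) d by (auto simp: \<tau>_def)
  have \<tau>_sum: "sum \<tau> {..<2 * N} = 1"
    using d by (simp add: sum2 \<tau>_def d_def perimeter_def flip: sum_divide_distrib add_divide_distrib)
  have step: "z (Suc j) = z j + \<tau> j *\<^sub>R V j" if j: "j < 2 * N" for j
  proof (cases "even j")
    case True
    then obtain i where i: "j = 2 * i" by blast
    then have "a (Suc i) = a i - \<sigma> i *\<^sub>R nrm (X i)" using a(3)[of i] j by (simp add: algebra_simps)
    then show ?thesis using d by (simp add: z_def \<tau>_def V_def i)
  next
    case False
    then obtain i where i: "j = Suc (2 * i)" by (metis oddE Suc_eq_plus1)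
    then have "X (Suc i) = X i + norm (X (Suc i) - X i) *\<^sub>R a (Suc i)" using side[of i] j by (simp add: algebra_simps)
    then show ?thesis using d by (simp add: z_def \<tau>_def V_def i)
  qed
  have closed: "z (2 * N) = z 0" using X(1) a(1) by (simp add: z_def)
  obtain \<gamma> where \<gamma>: "piecewise_smooth_loop \<gamma>"
    "\<And>t F. F \<in> {at_left t, at_right t} \<Longrightarrow> \<exists>j<2 * N. \<exists>s. 0 < \<tau> j \<and> 0 \<le> s \<and> s \<le> \<tau> j \<and>
        \<gamma> t = z j + s *\<^sub>R V j \<and> (\<gamma> has_vector_derivative V j) F"
    "loop_length (\<lambda>t. fst (\<gamma> t)) \<le> ereal (\<Sum>j<2 * N. \<tau> j * norm (fst (V j)))"
    using piecewise_linear_loop[OF \<tau>_nonneg \<tau>_sum step closed linear_fst] by blast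
  have "closed_KB_billiard K \<gamma>"
  proof (rule closed_KB_billiardI[OF \<gamma>(1) d])
    fix t :: real and F assume F: "F \<in> {at_left t, at_right t}"
    obtain j s where j: "j < 2 * N" "0 < \<tau> j" "0 \<le> s" "s \<le> \<tau> j" "\<gamma> t = z j + s *\<^sub>R V j"
      "(\<gamma> has_vector_derivative V j) F"
      using \<gamma>(2)[OF F] by blast
    define u where "u = s / \<tau> j"
    have u: "0 \<le> u" "u \<le> 1" "s = u * \<tau> j" using j by (simp_all add: u_def)
    have "\<gamma> t = z j + u *\<^sub>R (z (Suc j) - z j)" using j(5) step[OF j(1)] u(3) by simp
    then have seg: "\<gamma> t = (1 - u) *\<^sub>R z j + u *\<^sub>R z (Suc j)" by (simp add: algebra_simps)
    have "fst (\<gamma> t) \<in> K \<and> norm (snd (\<gamma> t)) = 1 \<and> V j = d *\<^sub>R (- snd (\<gamma> t), 0) \<or>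
       fst (\<gamma> t) \<in> frontier K \<and> norm (snd (\<gamma> t)) \<le> 1 \<and> V j = d *\<^sub>R (0, nrm (fst (\<gamma> t)))"
    proof (cases "even j")
      case True
      then obtain i where i: "j = 2 * i" by blast
      then have "i < N" "\<sigma> i \<noteq> 0" using j(1,2) by (auto simp: \<tau>_def)
      then have f: "X i \<in> frontier K" using \<sigma>(2) by simp
      have eq: "fst (\<gamma> t) = X i" "snd (\<gamma> t) = - ((1 - u) *\<^sub>R a i + u *\<^sub>R a (Suc i))"
        using seg by (simp_all add: z_def i flip: scaleR_add_left)
      have "norm ((1 - u) *\<^sub>R a i + u *\<^sub>R a (Suc i)) \<le> 1"
        using convexD_alt[OF convex_cball, of "a i" 0 1 "a (Suc i)" u] a(2)[of i] a(2)[of "Suc i"] \<open>i < N\<close> u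
        by simp
      then have "norm (snd (\<gamma> t)) \<le> 1" by (simp only: eq norm_minus_cancel)
      then show ?thesis using f by (simp add: eq(1) V_def i)
    next
      case False
      then obtain i where i: "j = Suc (2 * i)" by (metis oddE Suc_eq_plus1)
      then have "i < N" "X (Suc i) \<noteq> X i" using j(1,2) by (auto simp: \<tau>_def)
      have eq: "fst (\<gamma> t) = (1 - u) *\<^sub>R X i + u *\<^sub>R X (Suc i)" "snd (\<gamma> t) = - a (Suc i)"
        using seg by (simp_all add: z_def i algebra_simps)
      have "fst (\<gamma> t) \<in> K"
        unfolding eq by (rule convexD_alt[OF convex_table]) (use X(2) \<open>i < N\<close> u in auto)
      then show ?thesis using unit[OF \<open>i < N\<close> \<open>X (Suc i) \<noteq> X i\<close>] by (simp add: eq(2) V_def i)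
    qed
    then show "\<exists>v. (\<gamma> has_vector_derivative v) F \<and>
      (fst (\<gamma> t) \<in> K \<and> norm (snd (\<gamma> t)) = 1 \<and> v = d *\<^sub>R (- snd (\<gamma> t), 0) \<or>
       fst (\<gamma> t) \<in> frontier K \<and> norm (snd (\<gamma> t)) \<le> 1 \<and> v = d *\<^sub>R (0, nrm (fst (\<gamma> t))))"
      using j(6) by blast
  qed
  moreover have "(\<Sum>j<2 * N. \<tau> j * norm (fst (V j))) = perimeter N X"
  proof -
    have "norm (X (Suc i) - X i) * norm (a (Suc i)) = norm (X (Suc i) - X i)" if "i < N" for i
      using unit[OF that] by (cases "X (Suc i) = X i") auto
    then have "(\<Sum>i<N. norm (X (Suc i) - X i) * norm (a (Suc i))) = perimeter N X"
      unfolding perimeter_def by (intro sum.cong) auto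
    then show ?thesis using d by (simp add: sum2 \<tau>_def V_def)
  qed
  ultimately show ?thesis using that \<gamma>(3) by simp
qed

lemma shortest_pinned_polygon_billiard:
  assumes N: "0 < N" and pinned: "pinned_polygon N K X"
    and shortest: "\<And>Y. pinned_polygon N K Y \<Longrightarrow> perimeter N X \<le> perimeter N Y"
  obtains \<gamma> where "closed_KB_billiard K \<gamma>" "loop_length (\<lambda>t. fst (\<gamma> t)) \<le> ereal (perimeter N X)"
proof -
  obtain v where v: "\<And>i. i \<le> N \<Longrightarrow> X i + v \<in> K"
    using shortest_pinned_translates_into_table[OF N pinned shortest] by blast
  define W where "W i = X i + v" for i
  have perW: "perimeter N W = perimeter N X" by (simp add: W_def perimeter_def)
  have W_in: "\<And>i. i \<le> N \<Longrightarrow> W i \<in> K" using v by (simp add: W_def)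
  have pinnedW: "pinned_polygon N K W"
    using pinned_polygon_translate[OF pinned, of v] by (simp add: W_def[abs_def])
  have shortestW: "\<And>Y. pinned_polygon N K Y \<Longrightarrow> perimeter N W \<le> perimeter N Y"
    using shortest perW by simp
  note W = N pinnedW shortestW
  obtain \<mu> where \<mu>: "\<And>i. i < N \<Longrightarrow> 0 \<le> \<mu> i" "\<And>i. i < N \<Longrightarrow> \<mu> i \<noteq> 0 \<Longrightarrow> W i \<in> frontier K"
    "sum \<mu> {..<N} = 1" "(\<Sum>i<N. \<mu> i *\<^sub>R nrm (W i)) = 0"
    using shortest_pinned_polygon_normals[OF W W_in] by blast
  define m where "m = perimeter N W"
  have m: "0 < m" using shortest_pinned_perimeter_pos[OF W] by (simp add: m_def)
  \<comment> \<open>The prospective momentum jumps. The factor \<open>m\<close> turns the multiplier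
    bound into a lower bound on perimeters with constant 1; it is exact at \<open>W\<close> because
    each normal has product 1 with its own boundary point and the weights sum to 1.\<close>
  define c where "c i = (m * \<mu> i) *\<^sub>R nrm (W i)" for i
  have WN: "W N = W 0" using pinnedW by (simp add: pinned_polygon_def)
  have c_sum: "(\<Sum>i<N. c i) = 0"
    using \<mu>(4) by (simp add: c_def flip: scaleR_scaleR scaleR_sum_right)
  have c_inner: "(\<Sum>i<N. c i \<bullet> Y i) = m * (\<Sum>i<N. \<mu> i * (nrm (W i) \<bullet> Y i))" for Y
    by (simp add: c_def sum_distrib_left mult.assoc)
  have "\<mu> i * (nrm (W i) \<bullet> W i) = \<mu> i" if "i < N" for i
    using nrm_inner_self[OF \<mu>(2)[OF that]] by (cases "\<mu> i = 0") auto
  then have "(\<Sum>i<N. \<mu> i * (nrm (W i) \<bullet> W i)) = 1"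
    using \<mu>(3) by (metis (no_types, lifting) lessThan_iff sum.cong)
  then have "(\<Sum>i<N. c i \<bullet> W i) = perimeter N W" by (simp add: c_inner m_def)
  moreover have "(\<Sum>i<N. c i \<bullet> Y i) \<le> perimeter N Y" if "Y N = Y 0" for Y
    unfolding c_inner m_def by (rule shortest_pinned_polygon_bound[where X = W, OF W \<mu> that])
  ultimately obtain a where a: "a N = a 0" "\<And>i. i < N \<Longrightarrow> a i - a (Suc i) = c i"
    "\<And>i. i \<le> N \<Longrightarrow> norm (a i) \<le> 1"
    "\<And>i. i < N \<Longrightarrow> a (Suc i) \<bullet> (W (Suc i) - W i) = norm (W (Suc i) - W i)"
    using reflection_momenta_exist[OF N c_sum _ WN] by blast
  obtain \<gamma> where "closed_KB_billiard K \<gamma>" "loop_length (\<lambda>t. fst (\<gamma> t)) \<le> ereal (perimeter N W)"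
    by (rule polygon_billiard[where X = W and N = N and a = a and \<sigma> = "\<lambda>i. m * \<mu> i"])
      (use WN W_in a \<mu>(1,2) m in \<open>auto simp: c_def m_def\<close>)
  then show ?thesis using that perW by simp
qed

end

section \<open>The inradius bound\<close>

text \<open>\<open>GREATEST\<close> needs an attained maximum, which comes from compactness of the
  set of admissible pairs of centre and radius.\<close>

lemma
  fixes K :: "'a::euclidean_space set"
  assumes K: "compact K" "K \<noteq> {}"
  shows inrad_nonneg: "0 \<le> inrad K"
    and le_inrad: "\<And>x r. 0 \<le> r \<Longrightarrow> cball x r \<subseteq> K \<Longrightarrow> r \<le> inrad K"
proof -
  obtain B where B: "\<And>x. x \<in> K \<Longrightarrow> norm x \<le> B"
    using compact_imp_bounded[OF K(1)] bounded_iff by blast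
  \<comment> \<open>Parametrising the ball by the unit ball turns containment into closed conditions
    on the pair \<open>(x, r)\<close>.\<close>
  have cball_iff: "cball x r \<subseteq> K \<longleftrightarrow> (\<forall>u\<in>cball 0 1. x + r *\<^sub>R u \<in> K)" if "0 \<le> r" for x r
  proof
    assume K: "cball x r \<subseteq> K"
    have "x + r *\<^sub>R u \<in> cball x r" if "u \<in> cball 0 1" for u
      using that \<open>0 \<le> r\<close> by (simp add: dist_norm mult_left_le)
    with K show "\<forall>u\<in>cball 0 1. x + r *\<^sub>R u \<in> K" by blast
  next
    assume K: "\<forall>u\<in>cball 0 1. x + r *\<^sub>R u \<in> K"
    show "cball x r \<subseteq> K"
    proof
      fix y assume y: "y \<in> cball x r"
      show "y \<in> K"
      proof (cases "r = 0")
        case True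
        then show ?thesis using y bspec[OF K, of 0] by simp
      next
        case False
        then have "(1 / r) *\<^sub>R (y - x) \<in> cball 0 1"
          using y \<open>0 \<le> r\<close> by (simp add: dist_norm norm_minus_commute)
        from bspec[OF K this] show ?thesis using False by simp
      qed
    qed
  qed
  define Z where "Z = (K \<times> {0..B}) \<inter> (\<Inter>u\<in>cball 0 1. (\<lambda>z. fst z + snd z *\<^sub>R u) -` K)"
  have "closed (\<Inter>u\<in>cball 0 1. (\<lambda>z :: 'a \<times> real. fst z + snd z *\<^sub>R u) -` K)"
    by (intro closed_INT ballI closed_vimage compact_imp_closed K continuous_intros)
  then have "compact Z" unfolding Z_def by (intro compact_Int_closed compact_Times K compact_Icc)
  have Z_iff: "(x, r) \<in> Z \<longleftrightarrow> 0 \<le> r \<and> cball x r \<subseteq> K" for x r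
  proof
    assume *: "0 \<le> r \<and> cball x r \<subseteq> K"
    then have "x \<in> K" by auto
    \<comment> \<open>Two opposite boundary points of the ball bound its radius by
      \<open>B\<close>.\<close>
    obtain u :: 'a where u: "norm u = 1" using vector_choose_size zero_le_one by blast
    have "x + r *\<^sub>R u \<in> K" "x - r *\<^sub>R u \<in> K" using * u by (auto simp: dist_norm)
    then have "norm (x + r *\<^sub>R u) + norm (x - r *\<^sub>R u) \<le> B + B" by (intro add_mono B)
    then have "norm ((x + r *\<^sub>R u) - (x - r *\<^sub>R u)) \<le> B + B"
      using norm_triangle_ineq4 order_trans by blast
    also have "(x + r *\<^sub>R u) - (x - r *\<^sub>R u) = (r + r) *\<^sub>R u"
      unfolding scaleR_add_left by simp
    finally have "r \<le> B" using * u by simp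
    then show "(x, r) \<in> Z" using * \<open>x \<in> K\<close> cball_iff[of r x] by (simp add: Z_def)
  qed (auto simp: Z_def cball_iff)
  obtain x0 where "x0 \<in> K" using K(2) by blast
  then have "(x0, 0) \<in> Z" by (simp add: Z_iff)
  then obtain z where z: "z \<in> Z" "\<And>y. y \<in> Z \<Longrightarrow> snd y \<le> snd z"
    using continuous_attains_sup[OF \<open>compact Z\<close>, of snd] continuous_on_snd[OF continuous_on_id] by (metis empty_iff)
  have "inrad K = snd z"
    unfolding inrad_def
  proof (rule Greatest_equality)
    show "0 \<le> snd z \<and> (\<exists>x. cball x (snd z) \<subseteq> K)" using z(1) Z_iff[of "fst z" "snd z"] by auto
    show "r \<le> snd z" if "0 \<le> r \<and> (\<exists>x. cball x r \<subseteq> K)" for r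
      using that z(2) Z_iff by (metis snd_conv)
  qed
  then show "0 \<le> inrad K" and "\<And>x r. 0 \<le> r \<Longrightarrow> cball x r \<subseteq> K \<Longrightarrow> r \<le> inrad K"
    using z(1) Z_iff[of "fst z" "snd z"] z(2)[of "(_, _)"] Z_iff by simp_all
qed

lemma pinned_polygon_in_ball:
  fixes K :: "'a::euclidean_space set"
  assumes K: "compact K" "convex K" "K \<noteq> {}" and r: "inrad K < r"
  obtains X where "pinned_polygon (DIM('a) + 1) K X" "perimeter (DIM('a) + 1) X \<le> 2 * (real DIM('a) + 1) * r"
proof -
  define N where "N = DIM('a) + 1"
  have r0: "0 < r" using r inrad_nonneg[OF K(1,3)] by simp
  \<comment> \<open>Translations carrying \<open>y\<close> into \<open>K\<close>. A translation
    common to all \<open>y\<close> in the ball would place a ball of radius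
    \<open>r > inrad K\<close> inside \<open>K\<close>.\<close>
  define A where "A y = {v. y + v \<in> K}" for y
  have A_eq: "A y = (\<lambda>x. x - y) ` K" for y
    by (auto simp: A_def image_iff) (metis add_diff_cancel_left')
  have A: "closed (A y)" "convex (A y)" for y
    unfolding A_eq using K by (auto intro: compact_imp_closed compact_translation_subtract)
  have "K \<inter> \<Inter> (A ` cball 0 r) = {}"
  proof (rule ccontr)
    assume "\<not> ?thesis"
    then obtain v where "v \<in> \<Inter> (A ` cball 0 r)" by blast
    then have v: "y + v \<in> K" if "y \<in> cball 0 r" for y using that unfolding A_def by blast
    have "cball v r \<subseteq> K"
    proof
      fix w assume "w \<in> cball v r"
      then have "w - v \<in> cball 0 r" by (simp add: dist_norm norm_minus_commute)
      from v[OF this] show "w \<in> K" by simp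
    qed
    then show False using le_inrad[OF K(1,3), of r v] r r0 by simp
  qed
  then obtain I where I: "finite I" "I \<subseteq> cball 0 r" "K \<inter> \<Inter> (A ` I) = {}"
    using compact_imp_fip_image[OF K(1), of "cball 0 r" A] A(1) by blast
  \<comment> \<open>Adding the point 0 absorbs the extra set \<open>K = A 0\<close> left over from
    the compactness argument.\<close>
  define I0 where "I0 = insert 0 I"
  have "A 0 = K" by (simp add: A_def)
  then have I0: "finite I0" "I0 \<subseteq> cball 0 r" "\<Inter> (A ` I0) = {}" using I r0 by (auto simp: I0_def)
  obtain \<T> where T: "\<T> \<subseteq> A ` I0" "card \<T> \<le> N" "\<Inter> \<T> = {}"
  \<comment> \<open>Helly's theorem speaks of at least \<open>n + 1\<close> sets; a smaller family
    serves as it is.\<close>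
  proof (cases "card (A ` I0) \<ge> N")
    case True
    have "\<not> (\<forall>t. t \<subseteq> A ` I0 \<and> card t = DIM('a) + 1 \<longrightarrow> \<Inter> t \<noteq> {})"
      using Helly[of "A ` I0"] True A(2) I0(3) unfolding N_def by blast
    then obtain t where "t \<subseteq> A ` I0" "card t = DIM('a) + 1" "\<Inter> t = {}" by blast
    then show ?thesis using that[of t] by (simp add: N_def)
  next
    case False
    then show ?thesis using I0(3) that[of "A ` I0"] by simp
  qed
  \<comment> \<open>One point for each set, so that the bound on the number of sets bounds the
    number of vertices.\<close>
  obtain J where J: "J \<subseteq> I0" "inj_on A J" "\<T> = A ` J" using T(1) by (auto simp: subset_image_inj)
  have finJ: "finite J" using J(1) I0(1) finite_subset by blast
  have "J \<noteq> {}" using J(3) T(3) by auto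
  then have cardJ: "0 < card J" "card J \<le> N" using finJ J T(2) by (auto simp: card_gt_0_iff card_image)
  obtain h where h: "bij_betw h {0..<card J} J" using ex_bij_betw_nat_finite[OF finJ] by blast
  \<comment> \<open>Spare indices repeat \<open>h 0\<close>; as \<open>card J \<le> N\<close>, index
    \<open>N\<close> is among them, which closes the polygon.\<close>
  define X where "X i = (if i < card J then h i else h 0)" for i
  have h_in: "h i \<in> J" if "i < card J" for i using h that by (auto simp: bij_betw_def)
  have X_in: "X i \<in> J" for i using h_in cardJ by (simp add: X_def)
  have "pinned_polygon N K X"
    unfolding pinned_polygon_def
  proof (intro conjI notI)
    show "X N = X 0" using cardJ by (simp add: X_def)
    assume "\<exists>v. \<forall>i<N. X i + v \<in> interior K"
    then obtain v where v: "\<And>i. i < N \<Longrightarrow> X i + v \<in> K" using interior_subset by blast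
    have "v \<in> A y" if y: "y \<in> J" for y
    proof -
      have "y \<in> h ` {0..<card J}" using y bij_betw_imp_surj_on[OF h] by simp
      then obtain i where "i < card J" "h i = y" by auto
      then show ?thesis using v[of i] cardJ by (simp add: A_def X_def)
    qed
    then show False using T(3) J(3) by auto
  qed
  moreover have "perimeter N X \<le> 2 * (real DIM('a) + 1) * r"
  proof -
    have "norm (X i) \<le> r" for i using X_in J(1) I0(2) by (metis mem_cball_0 subsetD)
    then have "norm (X (Suc i)) + norm (X i) \<le> r + r" for i by (intro add_mono)
    then have "norm (X (Suc i) - X i) \<le> r + r" for i
      using norm_triangle_ineq4 order_trans by blast
    then have "perimeter N X \<le> (\<Sum>i<N. r + r)" unfolding perimeter_def by (intro sum_mono) auto
    then show ?thesis by (simp add: N_def algebra_simps)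
  qed
  ultimately show ?thesis using that unfolding N_def by blast
qed

lemma smooth_convex_body_billiard_table:
  fixes K :: "'a::euclidean_space set"
  assumes K: "smooth_convex_body K" and c: "c \<in> interior K"
  shows "billiard_table ((\<lambda>x. x - c) ` K)"
proof
  have K': "compact K" "convex K" "smooth_hypersurface (frontier K)"
    using K by (auto simp: smooth_convex_body_def convex_body_def)
  show "compact ((\<lambda>x. x - c) ` K)" "convex ((\<lambda>x. x - c) ` K)"
    using K' by (simp_all add: compact_translation_subtract)
  show "0 \<in> interior ((\<lambda>x. x - c) ` K)" using c by (simp add: interior_translation_subtract image_iff)
  have shift: "y \<in> (\<lambda>x. x - c) ` S \<longleftrightarrow> y + c \<in> S" for y and S :: "'a set"
    by (auto intro: image_eqI[of _ _ "y + c"])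
  have frontier_shift: "frontier ((\<lambda>x. x - c) ` K) = (\<lambda>x. x - c) ` frontier K"
    using frontier_translation[of "- c" K] by (simp add: image_def)
  fix x assume "x \<in> frontier ((\<lambda>x. x - c) ` K)"
  then have x: "x + c \<in> frontier K" unfolding frontier_shift shift .
  then obtain U and F :: "'a \<Rightarrow> real" where U: "open U" "x + c \<in> U" "smooth_on F U"
    "frontier K \<inter> U = {y\<in>U. F y = 0}" "\<forall>y\<in>frontier K \<inter> U. frechet_derivative F (at y) \<noteq> (\<lambda>_. 0)"
    using K'(3) unfolding smooth_hypersurface_def by metis
  let ?F' = "frechet_derivative F (at (x + c))"
  have "C_k_on (Suc 0) F U" using U(3) by (simp only: smooth_on_def)
  then have "F differentiable (at (x + c))" using U(2) by simp
  then have "(F has_derivative ?F') (at (x + c))" by (rule frechet_derivative_works[THEN iffD1])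
  then have "((\<lambda>y. F (y + c)) has_derivative ?F') (at x)"
    by (rule has_derivative_compose[rotated, where f = "\<lambda>y. y + c"]) (auto intro!: derivative_eq_intros)
  moreover have "open ((\<lambda>y. y - c) ` U)" using U(1) by (simp add: open_translation_subtract)
  moreover have "x \<in> (\<lambda>y. y - c) ` U" using U(2) by (simp add: shift)
  moreover have "frontier ((\<lambda>x. x - c) ` K) \<inter> (\<lambda>y. y - c) ` U = {y \<in> (\<lambda>y. y - c) ` U. F (y + c) = 0}"
  proof (rule set_eqI)
    fix y
    have "y + c \<in> frontier K \<and> y + c \<in> U \<longleftrightarrow> y + c \<in> U \<and> F (y + c) = 0" using U(4) by blast
    then show "y \<in> frontier ((\<lambda>x. x - c) ` K) \<inter> (\<lambda>y. y - c) ` U \<longleftrightarrow>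
        y \<in> {y \<in> (\<lambda>y. y - c) ` U. F (y + c) = 0}"
      by (simp add: frontier_shift shift)
  qed
  moreover have "?F' \<noteq> (\<lambda>_. 0)" using U(2,5) x by blast
  ultimately show "\<exists>U (F :: 'a \<Rightarrow> real) F'. open U \<and> x \<in> U \<and>
         (F has_derivative F') (at x) \<and> F' \<noteq> (\<lambda>_. 0) \<and> frontier ((\<lambda>x. x - c) ` K) \<inter> U = {y\<in>U. F y = 0}"
    by blast
qed

section \<open>Identification of the shortest trajectory length\<close>

lemma loop_length_translate:
  fixes q :: "real \<Rightarrow> 'a::real_normed_vector"
  shows "loop_length (\<lambda>t. q t - c) = loop_length q"
  by (simp add: loop_length_def dist_norm)

text \<open>Each trajectory comes with its own centre \<open>c\<close>, but pinnedness is unchanged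
  when \<open>K\<close> is translated, so all are compared with the same \<open>X\<close>. The
  trajectory built from \<open>X\<close> is at most as long as \<open>X\<close>, hence exactly as
  long.\<close>

lemma xi_eq_shortest_pinned_perimeter:
  fixes K :: "'a::euclidean_space set"
  assumes K: "smooth_convex_body K" and X: "pinned_polygon (DIM('a) + 1) K X"
    and shortest: "\<And>Y. pinned_polygon (DIM('a) + 1) K Y \<Longrightarrow>
      perimeter (DIM('a) + 1) X \<le> perimeter (DIM('a) + 1) Y"
  shows "xi K = ereal (perimeter (DIM('a) + 1) X)"
proof -
  have lower: "ereal (perimeter (DIM('a) + 1) X) \<le> loop_length q"
    if q: "periodic_billiard_trajectory K q" for q
  proof -
    obtain c p where c: "c \<in> interior K" and bil: "closed_KB_billiard ((\<lambda>x. x - c) ` K) (\<lambda>t. (q t - c, p t))"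
      using q unfolding periodic_billiard_trajectory_def by blast
    interpret billiard_table "(\<lambda>x. x - c) ` K" by (rule smooth_convex_body_billiard_table[OF K c])
    obtain Y where Y: "pinned_polygon (DIM('a) + 1) ((\<lambda>x. x - c) ` K) Y"
      "ereal (perimeter (DIM('a) + 1) Y) \<le> loop_length (\<lambda>t. fst (q t - c, p t))"
      by (rule billiard_pinned_polygon[OF bil])
    have "perimeter (DIM('a) + 1) X \<le> perimeter (DIM('a) + 1) Y"
      using shortest Y(1) pinned_polygon_translate_set by blast
    then show ?thesis using Y(2) by (simp add: loop_length_translate) (metis ereal_less_eq(3) order_trans)
  qed
  obtain c where c: "c \<in> interior K"
    using K unfolding smooth_convex_body_def convex_body_def by blast
  interpret billiard_table "(\<lambda>x. x - c) ` K" by (rule smooth_convex_body_billiard_table[OF K c])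
  obtain \<gamma> where \<gamma>: "closed_KB_billiard ((\<lambda>x. x - c) ` K) \<gamma>"
    "loop_length (\<lambda>t. fst (\<gamma> t)) \<le> ereal (perimeter (DIM('a) + 1) X)"
    by (rule shortest_pinned_polygon_billiard[of "DIM('a) + 1" X])
      (use X shortest in \<open>auto simp: pinned_polygon_translate_set\<close>)
  let ?q = "\<lambda>t. fst (\<gamma> t) + c"
  have traj: "periodic_billiard_trajectory K ?q"
    unfolding periodic_billiard_trajectory_def using c \<gamma>(1)
    by (intro exI[of _ c] exI[of _ "\<lambda>t. snd (\<gamma> t)"]) simp
  have "loop_length ?q = ereal (perimeter (DIM('a) + 1) X)"
    using lower[OF traj] \<gamma>(2) loop_length_translate[of ?q c] by simp
  then show ?thesis
    unfolding xi_def using traj lower by (intro Least_equality) auto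
qed

theorem theorem1p3:
  fixes K :: "(real ^ 'n) set"
  assumes "smooth_convex_body K"
  shows "xi K \<le> ereal (2 * (real CARD('n) + 1) * inrad K)"
proof -
  let ?N = "DIM(real ^ 'n) + 1"
  have K: "compact K" "convex K" "K \<noteq> {}"
    using assms unfolding smooth_convex_body_def convex_body_def by auto
  obtain X0 where "pinned_polygon ?N K X0"
    using pinned_polygon_in_ball[OF K, of "inrad K + 1"] by auto
  then obtain X where X: "pinned_polygon ?N K X" "\<And>Y. pinned_polygon ?N K Y \<Longrightarrow> perimeter ?N X \<le> perimeter ?N Y"
    using shortest_pinned_polygon_exists[of ?N K X0] by auto
  \<comment> \<open>A ball of radius \<open>inrad K\<close> itself does fit into \<open>K\<close>,
    so only larger radii yield pinned polygons; the bound follows by letting \<open>r\<close>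
    decrease to \<open>inrad K\<close>.\<close>
  have "perimeter ?N X \<le> 2 * (real CARD('n) + 1) * r" if r: "inrad K < r" for r
  proof -
    obtain Y where Y: "pinned_polygon ?N K Y" "perimeter ?N Y \<le> 2 * (real DIM(real ^ 'n) + 1) * r"
      by (rule pinned_polygon_in_ball[OF K r])
    show ?thesis using X(2)[OF Y(1)] Y(2) by simp
  qed
  then have "perimeter ?N X / (2 * (real CARD('n) + 1)) \<le> inrad K"
    by - (rule dense_ge, simp add: pos_divide_le_eq add_pos_nonneg mult.commute)
  then have "perimeter ?N X \<le> 2 * (real CARD('n) + 1) * inrad K"
    by (simp add: pos_divide_le_eq add_pos_nonneg mult.commute)
  then show ?thesis using xi_eq_shortest_pinned_perimeter[OF assms X] by simp
qed

end
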